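(* Let $\{\alpha_j\}_{j=0}^\infty\subset\mathbb{D}$ be an arbitrary sequence of Verblunsky coefficients (with $\sup_j|\alpha_j|=1$ allowed), and let $\mathcal{C}(\alpha)$ be its CMV matrix. Let $\mathcal{R}$ be the set of right limits $\tilde{\mathcal{C}}(\beta)$ of $\mathcal{C}(\alpha)$, where $\beta\in\prod_{j=-\infty}^\infty\overline{\mathbb{D}}$ is allowed to have some entries with $|\beta_j|=1$. Then $$\sigma_{\mathrm{ess}}(\mathcal{C}(\alpha))=\overline{\bigcup_{\tilde{\mathcal{C}}(\beta)\in\mathcal{R}}\sigma(\tilde{\mathcal{C}}(\beta))}.$$
   Context: $\mathbb{D}=\{z\in\mathbb{C}:|z|<1\}$ and $\overline{\mathbb{D}}$ is its closure. For $\alpha\in\overline{\mathbb{D}}$ put $\rho=(1-|\alpha|^2)^{1/2}$ and $\Theta(\alpha)=\begin{pmatrix}\bar\alpha&\rho\\ \rho&-\alpha\end{pmatrix}$ (diagonal when $|\alpha|=1$). For $\{\alpha_j\}_{j=0}^\infty\subset\mathbb{D}$ write $\Theta_j=\Theta(\alpha_j)$, $\mathcal{L}=\Theta_0\oplus\Theta_2\oplus\Theta_4\oplus\cdots$, $\mathcal{M}=\mathbf{1}\oplus\Theta_1\oplus\Theta_3\oplus\cdots$, where $\mathbf{1}$ is the $1\times1$ identity; the CMV matrix is the unitary operator $\mathcal{C}(\alpha)=\mathcal{L}\mathcal{M}$ on $\ell^2(\{0,1,2,\dots\})$. For a two-sided sequence $\{\beta_j\}_{j=-\infty}^\infty$ in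 $\overline{\mathbb{D}}$, with $\Theta_j=\Theta(\beta_j)$ acting on the span of $\delta_j$ and $\delta_{j+1}$ in $\ell^2(\mathbb{Z})$, put $\tilde{\mathcal{L}}=\cdots\oplus\Theta_{-2}\oplus\Theta_0\oplus\Theta_2\oplus\cdots$, $\tilde{\mathcal{M}}=\cdots\oplus\Theta_{-1}\oplus\Theta_1\oplus\Theta_3\oplus\cdots$, and $\tilde{\mathcal{C}}(\beta)=\tilde{\mathcal{L}}\tilde{\mathcal{M}}$. A two-sided sequence $\beta$ in $\overline{\mathbb{D}}$ is a right limit point of $\alpha$ if there is a sequence $m_j\to\infty$ such that $\lim_{j\to\infty}\alpha_{m_j+\ell}=\beta_\ell$ for every $\ell=0,\pm1,\pm2,\dots$; then $\tilde{\mathcal{C}}(\beta)$ is called a right limit of $\mathcal{C}(\alpha)$. $\sigma,\sigma_{\mathrm{ess}}$ denote spectrum and essential spectrum. *)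

theory Defs
  imports "HOL-Analysis.Analysis"
begin

section \<open>The complex Hilbert space of square-summable families\<close>

typedef 'i ell2 = "{x :: 'i \<Rightarrow> complex. (\<lambda>i. (cmod (x i))\<^sup>2) summable_on UNIV}"
  morphisms ell2_nth Abs_ell2
  by (rule exI[of _ "\<lambda>_. 0"]) simp

setup_lifting type_definition_ell2

lemma ell2_nth_summable: "(\<lambda>i. (cmod (ell2_nth x i))\<^sup>2) summable_on UNIV"
  using ell2_nth[of x] by simp

lemma ell2_eqI: "(\<And>i. ell2_nth x i = ell2_nth y i) \<Longrightarrow> x = y"
  by (metis ell2_nth_inject ext)

lemma cmod_add_sq_le: "(cmod (a + b))\<^sup>2 \<le> 2 * ((cmod a)\<^sup>2 + (cmod b)\<^sup>2)"
proof -
  have "(cmod (a + b))\<^sup>2 \<le> (cmod a + cmod b)\<^sup>2"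
    by (intro power_mono norm_triangle_ineq) auto
  also have "\<dots> \<le> 2 * ((cmod a)\<^sup>2 + (cmod b)\<^sup>2)"
    using zero_le_power2[of "cmod a - cmod b"] by (simp add: power2_eq_square algebra_simps)
  finally show ?thesis .
qed

lemma ell2_add_closed:
  fixes x y :: "'i \<Rightarrow> complex"
  assumes "(\<lambda>i. (cmod (x i))\<^sup>2) summable_on UNIV" "(\<lambda>i. (cmod (y i))\<^sup>2) summable_on UNIV"
  shows "(\<lambda>i. (cmod (x i + y i))\<^sup>2) summable_on UNIV"
proof (rule summable_on_comparison_test)
  show "(\<lambda>i. 2 * ((cmod (x i))\<^sup>2 + (cmod (y i))\<^sup>2)) summable_on UNIV"
    by (intro summable_on_cmult_right summable_on_add assms)
  show "(cmod (x i + y i))\<^sup>2 \<le> 2 * ((cmod (x i))\<^sup>2 + (cmod (y i))\<^sup>2)" for i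
    by (rule cmod_add_sq_le)
qed simp

lemma ell2_scale_closed:
  fixes x :: "'i \<Rightarrow> complex"
  assumes "(\<lambda>i. (cmod (x i))\<^sup>2) summable_on UNIV"
  shows "(\<lambda>i. (cmod (c * x i))\<^sup>2) summable_on UNIV"
  unfolding norm_mult power_mult_distrib by (intro summable_on_cmult_right assms)

lift_definition scaleC_ell2 :: "complex \<Rightarrow> 'i ell2 \<Rightarrow> 'i ell2" is "\<lambda>c x i. c * x i"
  by (rule ell2_scale_closed)

text \<open>
  The inner product of the class is the real part of the usual complex inner product, so that
  \<open>norm x = sqrt (\<Sum>\<^sub>\<infinity>i. (cmod (x i))\<^sup>2)\<close>.
\<close>

instantiation ell2 :: (type) real_inner
begin

lift_definition zero_ell2 :: "'a ell2" is "\<lambda>_. 0" by simp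
lift_definition plus_ell2 :: "'a ell2 \<Rightarrow> 'a ell2 \<Rightarrow> 'a ell2" is "\<lambda>x y i. x i + y i"
  by (simp add: ell2_add_closed)
lift_definition uminus_ell2 :: "'a ell2 \<Rightarrow> 'a ell2" is "\<lambda>x i. - x i" by simp
lift_definition minus_ell2 :: "'a ell2 \<Rightarrow> 'a ell2 \<Rightarrow> 'a ell2" is "\<lambda>x y i. x i - y i"
  subgoal for x y using ell2_add_closed[of x "\<lambda>i. - y i"] by simp
  done
lift_definition scaleR_ell2 :: "real \<Rightarrow> 'a ell2 \<Rightarrow> 'a ell2" is "\<lambda>r x i. of_real r * x i"
  by (rule ell2_scale_closed)
definition inner_ell2 :: "'a ell2 \<Rightarrow> 'a ell2 \<Rightarrow> real" where
  "inner_ell2 x y = (\<Sum>\<^sub>\<infinity>i. ell2_nth x i \<bullet> ell2_nth y i)"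
definition norm_ell2 :: "'a ell2 \<Rightarrow> real" where
  "norm_ell2 x = sqrt (inner x x)"
definition sgn_ell2 :: "'a ell2 \<Rightarrow> 'a ell2" where
  "sgn_ell2 x = inverse (norm x) *\<^sub>R x"
definition dist_ell2 :: "'a ell2 \<Rightarrow> 'a ell2 \<Rightarrow> real" where
  "dist_ell2 x y = norm (x - y)"
definition uniformity_ell2 :: "('a ell2 \<times> 'a ell2) filter" where
  "uniformity_ell2 = (INF e\<in>{0 <..}. principal {(x, y). dist x y < e})"
definition open_ell2 :: "'a ell2 set \<Rightarrow> bool" where
  "open_ell2 U = (\<forall>x\<in>U. eventually (\<lambda>(x', y). x' = x \<longrightarrow> y \<in> U) uniformity)"

lemma ell2_inner_summable: "(\<lambda>i. ell2_nth x i \<bullet> ell2_nth y i) summable_on UNIV"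
proof -
  have "(\<lambda>i. norm (ell2_nth x i \<bullet> ell2_nth y i)) summable_on UNIV"
  proof (rule summable_on_comparison_test)
    show "(\<lambda>i. (cmod (ell2_nth x i))\<^sup>2 + (cmod (ell2_nth y i))\<^sup>2) summable_on UNIV"
      by (intro summable_on_add ell2_nth_summable)
    fix i
    define a b where "a = cmod (ell2_nth x i)" and "b = cmod (ell2_nth y i)"
    have "norm (ell2_nth x i \<bullet> ell2_nth y i) \<le> a * b"
      by (simp add: a_def b_def Cauchy_Schwarz_ineq2)
    also have "\<dots> \<le> a\<^sup>2 + b\<^sup>2"
    proof -
      have "0 \<le> a * b" by (simp add: a_def b_def)
      then show ?thesis using sum_squares_bound[of a b] by linarith
    qed
    finally show "norm (ell2_nth x i \<bullet> ell2_nth y i)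
        \<le> (cmod (ell2_nth x i))\<^sup>2 + (cmod (ell2_nth y i))\<^sup>2"
      by (simp add: a_def b_def)
  qed auto
  then show ?thesis by (rule abs_summable_summable)
qed

instance
proof
  fix x y z :: "'a ell2" and a b r :: real
  show "x + y + z = x + (y + z)" "x + y = y + x" "0 + x = x" "- x + x = 0" "x - y = x + - y"
    by (transfer; simp add: algebra_simps)+
  show "a *\<^sub>R (x + y) = a *\<^sub>R x + a *\<^sub>R y" "(a + b) *\<^sub>R x = a *\<^sub>R x + b *\<^sub>R x"
    "a *\<^sub>R b *\<^sub>R x = (a * b) *\<^sub>R x" "1 *\<^sub>R x = x"
    by (transfer; simp add: algebra_simps)+
  show "sgn x = inverse (norm x) *\<^sub>R x" by (rule sgn_ell2_def)
  show "dist x y = norm (x - y)" by (rule dist_ell2_def)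
  show "uniformity = (INF e\<in>{0 <..}. principal {(x :: 'a ell2, y). dist x y < e})"
    by (rule uniformity_ell2_def)
  show "open U = (\<forall>x\<in>U. eventually (\<lambda>(x', y). x' = x \<longrightarrow> y \<in> U) uniformity)"
    for U :: "'a ell2 set" by (rule open_ell2_def)
  show "inner x y = inner y x" by (simp add: inner_ell2_def inner_commute)
  show "inner (x + y) z = inner x z + inner y z"
    by (simp add: inner_ell2_def plus_ell2.rep_eq inner_add_left infsum_add ell2_inner_summable)
  have *: "inner (of_real r * u) v = r * inner u v" for u v :: complex
    by (simp flip: scaleR_conv_of_real)
  show "inner (r *\<^sub>R x) y = r * inner x y"
    by (simp add: inner_ell2_def scaleR_ell2.rep_eq * infsum_cmult_right')
  show "0 \<le> inner x x" by (simp add: inner_ell2_def infsum_nonneg)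
  show "inner x x = 0 \<longleftrightarrow> x = 0"
  proof
    assume "inner x x = 0"
    then have "ell2_nth x i \<bullet> ell2_nth x i = 0" for i
      using nonneg_infsum_le_0D[of "\<lambda>i. ell2_nth x i \<bullet> ell2_nth x i" UNIV i]
        ell2_inner_summable[of x x] by (simp add: inner_ell2_def)
    then show "x = 0" by (intro ell2_eqI) (simp add: zero_ell2.rep_eq)
  next
    assume "x = 0" then show "inner x x = 0" by (simp add: inner_ell2_def zero_ell2.rep_eq)
  qed
  show "norm x = sqrt (inner x x)" by (rule norm_ell2_def)
qed

end

lemma norm_ell2_eq: "norm x = sqrt (\<Sum>\<^sub>\<infinity>i. (cmod (ell2_nth x i))\<^sup>2)"
  by (simp add: norm_ell2_def inner_ell2_def power2_norm_eq_inner)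

global_interpretation ell2: vector_space "scaleC_ell2 :: complex \<Rightarrow> 'i ell2 \<Rightarrow> 'i ell2"
  by unfold_locales (transfer; simp add: algebra_simps)+


section \<open>Spectrum and essential spectrum\<close>

definition bounded_clinear :: "('i ell2 \<Rightarrow> 'j ell2) \<Rightarrow> bool" where
  "bounded_clinear T \<longleftrightarrow>
     bounded_linear T \<and> (\<forall>c x. T (scaleC_ell2 c x) = scaleC_ell2 c (T x))"

definition shifted :: "('i ell2 \<Rightarrow> 'i ell2) \<Rightarrow> complex \<Rightarrow> 'i ell2 \<Rightarrow> 'i ell2" where
  "shifted T z = (\<lambda>x. T x - scaleC_ell2 z x)"

definition spectrum :: "('i ell2 \<Rightarrow> 'i ell2) \<Rightarrow> complex set" where
  "spectrum T =
     {z. \<not> (\<exists>S. bounded_clinear S \<and> S \<circ> shifted T z = id \<and> shifted T z \<circ> S = id)}"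

text \<open>
  Dimension and codimension are over the complex numbers: \<open>ell2.span\<close> is the complex linear span.
\<close>

definition fredholm :: "('i ell2 \<Rightarrow> 'j ell2) \<Rightarrow> bool" where
  "fredholm T \<longleftrightarrow>
     bounded_clinear T \<and>
     (\<exists>B. finite B \<and> {x. T x = 0} = ell2.span B) \<and>
     closed (range T) \<and>
     (\<exists>B. finite B \<and> ell2.span (range T \<union> B) = UNIV)"

definition ess_spectrum :: "('i ell2 \<Rightarrow> 'i ell2) \<Rightarrow> complex set" where
  "ess_spectrum T = {z. \<not> fredholm (shifted T z)}"


section \<open>CMV matrices\<close>

definition Theta :: "complex \<Rightarrow> complex^2^2" where
  "Theta a =
     (let \<rho> = complex_of_real (sqrt (1 - (cmod a)\<^sup>2))
      in vector [vector [cnj a, \<rho>],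
                 vector [\<rho>, - a]])"

text \<open>
  The direct sums are given by their action on coordinates. The block \<open>Theta (\<alpha> j)\<close> acts on the
  coordinates \<open>j\<close> and \<open>j + 1\<close>, so coordinate \<open>n\<close> of the image is the first component of block
  \<open>n\<close> or the second component of block \<open>n - 1\<close>. The use of \<open>Abs_ell2\<close> is justified below for
  coefficients in the closed unit disc.
\<close>

definition CMV_L :: "(nat \<Rightarrow> complex) \<Rightarrow> nat ell2 \<Rightarrow> nat ell2" where
  "CMV_L \<alpha> x = Abs_ell2 (\<lambda>n.
     if even n then (Theta (\<alpha> n) *v vector [ell2_nth x n, ell2_nth x (n + 1)]) $ 1
     else (Theta (\<alpha> (n - 1)) *v vector [ell2_nth x (n - 1), ell2_nth x n]) $ 2)"

definition CMV_M :: "(nat \<Rightarrow> complex) \<Rightarrow> nat ell2 \<Rightarrow> nat ell2" where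
  "CMV_M \<alpha> x = Abs_ell2 (\<lambda>n.
     if n = 0 then ell2_nth x 0
     else if odd n then (Theta (\<alpha> n) *v vector [ell2_nth x n, ell2_nth x (n + 1)]) $ 1
     else (Theta (\<alpha> (n - 1)) *v vector [ell2_nth x (n - 1), ell2_nth x n]) $ 2)"

definition CMV :: "(nat \<Rightarrow> complex) \<Rightarrow> nat ell2 \<Rightarrow> nat ell2" where
  "CMV \<alpha> = CMV_L \<alpha> \<circ> CMV_M \<alpha>"

definition ext_CMV_L :: "(int \<Rightarrow> complex) \<Rightarrow> int ell2 \<Rightarrow> int ell2" where
  "ext_CMV_L \<beta> x = Abs_ell2 (\<lambda>n.
     if even n then (Theta (\<beta> n) *v vector [ell2_nth x n, ell2_nth x (n + 1)]) $ 1
     else (Theta (\<beta> (n - 1)) *v vector [ell2_nth x (n - 1), ell2_nth x n]) $ 2)"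

definition ext_CMV_M :: "(int \<Rightarrow> complex) \<Rightarrow> int ell2 \<Rightarrow> int ell2" where
  "ext_CMV_M \<beta> x = Abs_ell2 (\<lambda>n.
     if odd n then (Theta (\<beta> n) *v vector [ell2_nth x n, ell2_nth x (n + 1)]) $ 1
     else (Theta (\<beta> (n - 1)) *v vector [ell2_nth x (n - 1), ell2_nth x n]) $ 2)"

definition ext_CMV :: "(int \<Rightarrow> complex) \<Rightarrow> int ell2 \<Rightarrow> int ell2" where
  "ext_CMV \<beta> = ext_CMV_L \<beta> \<circ> ext_CMV_M \<beta>"

lemma Theta_mult_vector:
  "(Theta a *v vector [u, v]) $ 1 = cnj a * u + complex_of_real (sqrt (1 - (cmod a)\<^sup>2)) * v"
  "(Theta a *v vector [u, v]) $ 2 = complex_of_real (sqrt (1 - (cmod a)\<^sup>2)) * u - a * v"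
  by (simp_all add: Theta_def Let_def matrix_vector_mult_def sum_2)

lemma Theta_mult_vector_le:
  assumes "cmod a \<le> 1"
  shows "(cmod ((Theta a *v vector [u, v]) $ i))\<^sup>2 \<le> 2 * ((cmod u)\<^sup>2 + (cmod v)\<^sup>2)"
proof -
  define r where "r = complex_of_real (sqrt (1 - (cmod a)\<^sup>2))"
  have *: "(cmod (p * u + q * v))\<^sup>2 \<le> 2 * ((cmod u)\<^sup>2 + (cmod v)\<^sup>2)"
    if "cmod p \<le> 1" "cmod q \<le> 1" for p q
  proof -
    have "(cmod (p * u))\<^sup>2 \<le> (cmod u)\<^sup>2" "(cmod (q * v))\<^sup>2 \<le> (cmod v)\<^sup>2"
      using that by (auto simp only: norm_mult intro!: power_mono mult_left_le_one_le
          mult_nonneg_nonneg norm_ge_zero)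
    then have "2 * ((cmod (p * u))\<^sup>2 + (cmod (q * v))\<^sup>2) \<le> 2 * ((cmod u)\<^sup>2 + (cmod v)\<^sup>2)"
      by (intro mult_left_mono add_mono) simp_all
    with cmod_add_sq_le show ?thesis by (rule order_trans)
  qed
  have r: "cmod r \<le> 1" using assms by (simp add: r_def power_le_one)
  have eq: "(Theta a *v vector [u, v]) $ 1 = cnj a * u + r * v"
    "(Theta a *v vector [u, v]) $ 2 = r * u + (- a) * v"
    by (simp_all add: Theta_mult_vector r_def)
  have "cmod (cnj a) \<le> 1" "cmod (- a) \<le> 1" using assms by simp_all
  with * r exhaust_2[of i] show ?thesis by (metis eq)
qed

lemma ell2_nth_Abs:
  assumes "f summable_on UNIV" "\<And>i. (cmod (y i))\<^sup>2 \<le> (f i :: real)"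
  shows "ell2_nth (Abs_ell2 y) = y"
  using summable_on_comparison_test[OF assms(1), of "\<lambda>i. (cmod (y i))\<^sup>2"] assms(2)
  by (simp add: Abs_ell2_inverse)

lemma ell2_neighbour_summable:
  fixes x :: "nat ell2" and y :: "int ell2"
  defines "s \<equiv> \<lambda>n. (cmod (ell2_nth x n))\<^sup>2" and "t \<equiv> \<lambda>n. (cmod (ell2_nth y n))\<^sup>2"
  shows "(\<lambda>n. 2 * (s (n - 1) + s n + s (n + 1))) summable_on UNIV"
    and "(\<lambda>n. 2 * (t (n - 1) + t n + t (n + 1))) summable_on UNIV"
proof -
  have s: "summable s"
    using ell2_nth_summable[of x] by (simp add: s_def summable_on_UNIV_nonneg_real_iff)
  have "summable (\<lambda>n. s (n - 1))" using s summable_Suc_iff[of "\<lambda>n. s (n - 1)"] by simp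
  moreover have "summable (\<lambda>n. s (n + 1))" using s summable_Suc_iff[of s] by simp
  ultimately have "summable (\<lambda>n. 2 * (s (n - 1) + s n + s (n + 1)))"
    using s by (intro summable_mult summable_add)
  then show "(\<lambda>n. 2 * (s (n - 1) + s n + s (n + 1))) summable_on UNIV"
    by (subst summable_on_UNIV_nonneg_real_iff) (auto simp: s_def)
  have t: "t summable_on UNIV" unfolding t_def by (rule ell2_nth_summable)
  have "(\<lambda>n. t (n + c)) summable_on UNIV" for c
    using t by (subst summable_on_reindex_bij_betw[of "\<lambda>n. n + c" UNIV UNIV t])
      (auto intro!: bij_betwI[of _ _ _ "\<lambda>n. n - c"])
  from this[of "-1"] this[of 1] t
  show "(\<lambda>n. 2 * (t (n - 1) + t n + t (n + 1))) summable_on UNIV"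
    by (intro summable_on_cmult_right summable_on_add) auto
qed

lemma ell2_nth_CMV_L:
  assumes "\<And>j. cmod (\<alpha> j) \<le> 1"
  shows "ell2_nth (CMV_L \<alpha> x) n =
     (if even n then (Theta (\<alpha> n) *v vector [ell2_nth x n, ell2_nth x (n + 1)]) $ 1
      else (Theta (\<alpha> (n - 1)) *v vector [ell2_nth x (n - 1), ell2_nth x n]) $ 2)"
  unfolding CMV_L_def
  by (subst ell2_nth_Abs[OF ell2_neighbour_summable(1)[of x]])
    (auto intro!: order_trans[OF Theta_mult_vector_le[OF assms]])

lemma ell2_nth_CMV_M:
  assumes "\<And>j. cmod (\<alpha> j) \<le> 1"
  shows "ell2_nth (CMV_M \<alpha> x) n =
     (if n = 0 then ell2_nth x 0
      else if odd n then (Theta (\<alpha> n) *v vector [ell2_nth x n, ell2_nth x (n + 1)]) $ 1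
      else (Theta (\<alpha> (n - 1)) *v vector [ell2_nth x (n - 1), ell2_nth x n]) $ 2)"
  unfolding CMV_M_def
  by (subst ell2_nth_Abs[OF ell2_neighbour_summable(1)[of x]])
    (auto intro!: order_trans[OF Theta_mult_vector_le[OF assms]])

lemma ell2_nth_ext_CMV_L:
  assumes "\<And>j. cmod (\<beta> j) \<le> 1"
  shows "ell2_nth (ext_CMV_L \<beta> x) n =
     (if even n then (Theta (\<beta> n) *v vector [ell2_nth x n, ell2_nth x (n + 1)]) $ 1
      else (Theta (\<beta> (n - 1)) *v vector [ell2_nth x (n - 1), ell2_nth x n]) $ 2)"
  unfolding ext_CMV_L_def
  by (subst ell2_nth_Abs[OF ell2_neighbour_summable(2)[of x]])
    (auto intro!: order_trans[OF Theta_mult_vector_le[OF assms]])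

lemma ell2_nth_ext_CMV_M:
  assumes "\<And>j. cmod (\<beta> j) \<le> 1"
  shows "ell2_nth (ext_CMV_M \<beta> x) n =
     (if odd n then (Theta (\<beta> n) *v vector [ell2_nth x n, ell2_nth x (n + 1)]) $ 1
      else (Theta (\<beta> (n - 1)) *v vector [ell2_nth x (n - 1), ell2_nth x n]) $ 2)"
  unfolding ext_CMV_M_def
  by (subst ell2_nth_Abs[OF ell2_neighbour_summable(2)[of x]])
    (auto intro!: order_trans[OF Theta_mult_vector_le[OF assms]])


section \<open>Right limits\<close>

text \<open>
  For each \<open>l\<close> the index \<open>m j + l\<close> is nonnegative for all large \<open>j\<close>, so the truncation
  by \<open>nat\<close> does not affect the limit.
\<close>

definition right_limit_point :: "(nat \<Rightarrow> complex) \<Rightarrow> (int \<Rightarrow> complex) \<Rightarrow> bool" where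
  "right_limit_point \<alpha> \<beta> \<longleftrightarrow>
     (\<forall>l. cmod (\<beta> l) \<le> 1) \<and>
     (\<exists>m :: nat \<Rightarrow> nat. filterlim m at_top sequentially \<and>
        (\<forall>l. (\<lambda>j. \<alpha> (nat (int (m j) + l))) \<longlonglongrightarrow> \<beta> l))"

definition right_limits :: "(nat \<Rightarrow> complex) \<Rightarrow> (int ell2 \<Rightarrow> int ell2) set" where
  "right_limits \<alpha> = {ext_CMV \<beta> | \<beta>. right_limit_point \<alpha> \<beta>}"

end

theory Submission
  imports Defs "HOL-Complex_Analysis.Great_Picard"
begin

text \<open>
  A point \<open>z\<close> is in the essential spectrum iff \<open>C - z\<close> has approximate null vectors supported
  arbitrarily far out. Multiplying \<open>L M - z\<close> by \<open>L\<^sup>-\<^sup>1\<close> gives the tridiagonal operator \<open>M - z L\<^sup>-\<^sup>1\<close>, so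
  such vectors can be cut down to windows of bounded length; translating the windows to the origin
  and passing to a limit yields an approximate null vector for a right limit. Since right limits
  are unitary, an approximate null vector forces spectrum nearby. Conversely, approximate
  null vectors of a right limit are translated out to infinity.
\<close>

section \<open>The Hilbert space\<close>

text \<open>Entries of modulus one in a right limit make \<open>Theta\<close> diagonal and cut the
  two-sided matrix into pieces, so no lower bound on \<open>rho\<close> survives in the limit. Every
  passage to a limit therefore rests only on the entries of the tridiagonal operator being
  continuous in the coefficients on the closed disc. The strict bound on the \<alpha> enters through
  \<open>rho\<close> being nonzero on the half-line: formal eigenvectors are then unique up to a
  scalar, and far-out approximate null vectors rule out a closed range.

  The window length must be fixed before passing to the limit, since over growing windows normalized
  vectors could spread out and converge to zero. It depends on the accuracy wanted, and so does the
  right limit obtained. For each accuracy there is only spectrum near \<open>z\<close>, which is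
  where the closure comes from.

  Besides being tridiagonal, the modified operator behaves well under translation: an odd
  translation turns \<open>L M\<close> into a product in the opposite order, which is no CMV matrix,
  whereas the modified operator merely changes its parity parameter.\<close>

notation scaleC_ell2 (infixr "*\<^sub>C" 75)

lemmas ell2_nth_simps [simp] =
  zero_ell2.rep_eq plus_ell2.rep_eq uminus_ell2.rep_eq minus_ell2.rep_eq
  scaleR_ell2.rep_eq scaleC_ell2.rep_eq

lemma ell2_nth_sum [simp]: "ell2_nth (\<Sum>a\<in>A. f a) i = (\<Sum>a\<in>A. ell2_nth (f a) i)"
  by (induction A rule: infinite_finite_induct) auto

lemma scaleR_ell2_eq_scaleC: "r *\<^sub>R x = of_real r *\<^sub>C x"
  by (rule ell2_eqI) simp

lemma norm_ell2_sq: "(norm x)\<^sup>2 = (\<Sum>\<^sub>\<infinity>i. (cmod (ell2_nth x i))\<^sup>2)"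
  by (simp add: norm_ell2_eq infsum_nonneg)

lemma norm_scaleC_ell2 [simp]: "norm (c *\<^sub>C x) = cmod c * norm x"
  by (simp add: norm_ell2_eq norm_mult power_mult_distrib infsum_cmult_right' real_sqrt_mult)

lemma sum_le_norm_ell2_sq: "finite F \<Longrightarrow> (\<Sum>i\<in>F. (cmod (ell2_nth x i))\<^sup>2) \<le> (norm x)\<^sup>2"
  unfolding norm_ell2_sq by (intro finite_sum_le_infsum ell2_nth_summable) auto

lemma cmod_nth_le_norm: "cmod (ell2_nth x i) \<le> norm x"
  by (rule power2_le_imp_le) (use sum_le_norm_ell2_sq[of "{i}" x] in simp_all)

lemma norm_ell2_sq_finite:
  assumes "finite F" "\<And>i. i \<notin> F \<Longrightarrow> ell2_nth x i = 0"
  shows "(norm x)\<^sup>2 = (\<Sum>i\<in>F. (cmod (ell2_nth x i))\<^sup>2)"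
proof -
  have "(\<Sum>\<^sub>\<infinity>i. (cmod (ell2_nth x i))\<^sup>2) = (\<Sum>\<^sub>\<infinity>i\<in>F. (cmod (ell2_nth x i))\<^sup>2)"
    by (rule infsum_cong_neutral) (use assms in auto)
  then show ?thesis using assms by (simp add: norm_ell2_sq)
qed

text \<open>The hypothesis involves finite sums only, so it survives coordinatewise limits. This is
  how limits are shown to be square-summable.\<close>

lemma ell2_of_bounded_sums:
  assumes "\<And>F. finite F \<Longrightarrow> (\<Sum>i\<in>F. (cmod (f i))\<^sup>2) \<le> B"
  shows "ell2_nth (Abs_ell2 f) = f" "(norm (Abs_ell2 f))\<^sup>2 \<le> B"
proof -
  have s: "(\<lambda>i. (cmod (f i))\<^sup>2) summable_on UNIV"
    by (rule nonneg_bdd_above_summable_on) (use assms in \<open>auto intro!: bdd_aboveI\<close>)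
  then show 1: "ell2_nth (Abs_ell2 f) = f" by (simp add: Abs_ell2_inverse)
  show "(norm (Abs_ell2 f))\<^sup>2 \<le> B"
    unfolding norm_ell2_sq 1 by (rule infsum_le_finite_sums[OF s]) (use assms in auto)
qed

text \<open>Completeness supports the fixed point arguments for resolvents and the closed range
  arguments below.\<close>

instance ell2 :: (type) banach
proof
  fix X :: "nat \<Rightarrow> 'a ell2" assume C: "Cauchy X"
  have "Cauchy (\<lambda>n. ell2_nth (X n) i)" for i
  proof (rule metric_CauchyI)
    fix e :: real assume "e > 0"
    then obtain M where "\<And>m n. m \<ge> M \<Longrightarrow> n \<ge> M \<Longrightarrow> dist (X m) (X n) < e"
      using metric_CauchyD[OF C] by blast
    moreover have "dist (ell2_nth (X m) i) (ell2_nth (X n) i) \<le> dist (X m) (X n)" for m n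
      using cmod_nth_le_norm[of "X m - X n" i] by (simp add: dist_norm)
    ultimately show "\<exists>M. \<forall>m\<ge>M. \<forall>n\<ge>M. dist (ell2_nth (X m) i) (ell2_nth (X n) i) < e"
      by (meson le_less_trans)
  qed
  then have "\<forall>i. \<exists>l. (\<lambda>n. ell2_nth (X n) i) \<longlonglongrightarrow> l"
    by (simp add: Cauchy_convergent_iff convergent_def)
  then obtain f where f: "\<And>i. (\<lambda>n. ell2_nth (X n) i) \<longlonglongrightarrow> f i"
    using choice[of "\<lambda>i l. (\<lambda>n. ell2_nth (X n) i) \<longlonglongrightarrow> l"] by blast
  have tail: "(\<Sum>i\<in>F. (cmod (ell2_nth (X m) i - f i))\<^sup>2) \<le> e\<^sup>2"
    if "finite F" "e > 0" "\<And>n. n \<ge> M \<Longrightarrow> dist (X m) (X n) < e" for F e m M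
  proof (rule tendsto_upperbound)
    show "(\<lambda>n. \<Sum>i\<in>F. (cmod (ell2_nth (X m) i - ell2_nth (X n) i))\<^sup>2)
        \<longlonglongrightarrow> (\<Sum>i\<in>F. (cmod (ell2_nth (X m) i - f i))\<^sup>2)"
      by (intro tendsto_intros f)
    show "\<forall>\<^sub>F n in sequentially. (\<Sum>i\<in>F. (cmod (ell2_nth (X m) i - ell2_nth (X n) i))\<^sup>2) \<le> e\<^sup>2"
      using eventually_ge_at_top[of M]
    proof eventually_elim
      case (elim n)
      have "(\<Sum>i\<in>F. (cmod (ell2_nth (X m) i - ell2_nth (X n) i))\<^sup>2) \<le> (norm (X m - X n))\<^sup>2"
        using sum_le_norm_ell2_sq[of F "X m - X n"] that(1) by simp
      also have "\<dots> \<le> e\<^sup>2"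
        using that(3)[OF elim] by (intro power_mono) (auto simp: dist_norm)
      finally show ?case .
    qed
  qed simp
  have "\<exists>M. \<forall>m\<ge>M. \<forall>n\<ge>M. dist (X m) (X n) < e" if "e > 0" for e
    using metric_CauchyD[OF C that] by blast
  then have "\<forall>e. \<exists>M. e > 0 \<longrightarrow> (\<forall>m\<ge>M. \<forall>n\<ge>M. dist (X m) (X n) < e)" by blast
  from choice[OF this] obtain M where
    M: "\<And>e m n. e > 0 \<Longrightarrow> m \<ge> M e \<Longrightarrow> n \<ge> M e \<Longrightarrow> dist (X m) (X n) < e"
    by blast
  define D where "D m = Abs_ell2 (\<lambda>i. ell2_nth (X m) i - f i)" for m
  have D: "ell2_nth (D m) = (\<lambda>i. ell2_nth (X m) i - f i)" "(norm (D m))\<^sup>2 \<le> e\<^sup>2"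
    if "e > 0" "m \<ge> M e" for m e
  proof -
    have *: "\<And>F. finite F \<Longrightarrow> (\<Sum>i\<in>F. (cmod (ell2_nth (X m) i - f i))\<^sup>2) \<le> e\<^sup>2"
      using tail[where M="M e"] M that by simp
    show "ell2_nth (D m) = (\<lambda>i. ell2_nth (X m) i - f i)" "(norm (D m))\<^sup>2 \<le> e\<^sup>2"
      unfolding D_def by (rule ell2_of_bounded_sums[OF *]; assumption)+
  qed
  \<comment> \<open>The coordinatewise limit \<open>f\<close> is not yet known to be
    square-summable, but its difference from \<open>X (M 1)\<close> is.\<close>
  define Y where "Y = X (M 1) - D (M 1)"
  have Y: "ell2_nth Y i = f i" for i using D(1)[of 1 "M 1"] by (simp add: Y_def)
  have "X \<longlonglongrightarrow> Y"
  proof (rule metric_LIMSEQ_I)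
    fix e :: real assume "e > 0"
    have "dist (X m) Y < e" if "m \<ge> M (e/2)" for m
    proof -
      have "X m - Y = D m"
        by (rule ell2_eqI) (use D(1)[of "e/2" m] \<open>e > 0\<close> that Y in simp)
      then have "(norm (X m - Y))\<^sup>2 \<le> (e/2)\<^sup>2" using D(2)[of "e/2" m] \<open>e > 0\<close> that by simp
      then have "norm (X m - Y) \<le> e/2" by (rule power2_le_imp_le) (use \<open>e > 0\<close> in simp)
      then show ?thesis using \<open>e > 0\<close> by (simp add: dist_norm)
    qed
    then show "\<exists>no. \<forall>n\<ge>no. dist (X n) Y < e" by blast
  qed
  then show "convergent X" by (rule convergentI)
qed

section \<open>Truncation to a set of coordinates\<close>

definition trunc :: "'i set \<Rightarrow> 'i ell2 \<Rightarrow> 'i ell2" where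
  "trunc F x = Abs_ell2 (\<lambda>i. if i \<in> F then ell2_nth x i else 0)"

lemma ell2_nth_trunc [simp]: "ell2_nth (trunc F x) i = (if i \<in> F then ell2_nth x i else 0)"
  unfolding trunc_def by (subst ell2_nth_Abs[OF ell2_nth_summable[of x]]) auto

lemma norm_trunc_sq: "(norm (trunc F x))\<^sup>2 + (norm (trunc (- F) x))\<^sup>2 = (norm x)\<^sup>2"
  unfolding norm_ell2_sq
  by (subst infsum_add[symmetric, OF ell2_nth_summable ell2_nth_summable]) (auto intro!: infsum_cong)

lemma norm_trunc_le: "norm (trunc F x) \<le> norm x"
  by (rule power2_le_imp_le) (use norm_trunc_sq[of F x] zero_le_power2[of "norm (trunc (- F) x)"] in linarith, simp)

lemma trunc_approx:
  assumes "e > 0"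
  obtains F where "finite F" "norm (x - trunc F x) < e"
proof -
  obtain F where F: "finite F"
    "dist (\<Sum>i\<in>F. (cmod (ell2_nth x i))\<^sup>2) (\<Sum>\<^sub>\<infinity>i. (cmod (ell2_nth x i))\<^sup>2) \<le> e\<^sup>2 / 2"
    using infsum_finite_approximation[OF ell2_nth_summable[of x], of "e\<^sup>2/2"] assms by auto
  have 1: "(norm (trunc F x))\<^sup>2 = (\<Sum>i\<in>F. (cmod (ell2_nth x i))\<^sup>2)"
    using norm_ell2_sq_finite[of F "trunc F x"] F(1) by simp
  have 2: "x - trunc F x = trunc (- F) x" by (rule ell2_eqI) simp
  have "(norm (x - trunc F x))\<^sup>2 \<le> e\<^sup>2/2"
    using F(2) norm_trunc_sq[of F x] 1 2
    by (simp add: dist_real_def norm_ell2_sq[of x, symmetric] abs_if split: if_splits)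
  also have "\<dots> < e\<^sup>2" using assms by simp
  finally have "norm (x - trunc F x) < e" by (rule power2_less_imp_less) (use assms in simp)
  then show ?thesis by (rule that[OF F(1)])
qed

section \<open>Spectra of unitary operators\<close>

lemma bounded_clinearI:
  assumes "\<And>x y. T (x + y) = T x + T y" "\<And>c x. T (c *\<^sub>C x) = c *\<^sub>C T x" "\<And>x. norm (T x) \<le> norm x * K"
  shows "bounded_clinear T"
  unfolding bounded_clinear_def
  by (auto intro!: bounded_linear_intro[of T K] simp: scaleR_ell2_eq_scaleC assms)

context
  fixes T :: "'i ell2 \<Rightarrow> 'j ell2"
  assumes T: "bounded_clinear T"
begin

lemma bounded_clinear_bl: "bounded_linear T"
  using T by (simp add: bounded_clinear_def)

lemma bounded_clinear_scaleC: "T (c *\<^sub>C x) = c *\<^sub>C T x"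
  using T by (simp add: bounded_clinear_def)

lemma bounded_clinear_add: "T (x + y) = T x + T y"
  using bounded_clinear_bl by (rule bounded_linear.linear[THEN linear_add])

lemma bounded_clinear_diff: "T (x - y) = T x - T y"
  using bounded_clinear_bl by (rule bounded_linear.linear[THEN linear_diff])

lemma bounded_clinear_0: "T 0 = 0"
  using bounded_clinear_bl by (rule bounded_linear.linear[THEN linear_0])

lemma bounded_clinear_sum: "T (\<Sum>a\<in>A. f a) = (\<Sum>a\<in>A. T (f a))"
  using bounded_clinear_bl by (rule bounded_linear.linear[THEN linear_sum])

end

lemmas bounded_clinear_simps = bounded_clinear_scaleC bounded_clinear_add bounded_clinear_diff
  bounded_clinear_0

lemma bounded_clinear_compose:
  "bounded_clinear S \<Longrightarrow> bounded_clinear T \<Longrightarrow> bounded_clinear (S \<circ> T)"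
  by (auto simp: bounded_clinear_def o_def intro: bounded_linear_compose)

lemma bounded_clinear_shifted:
  assumes "bounded_clinear T"
  shows "bounded_clinear (shifted T z)"
proof -
  obtain K where "\<And>x. norm (T x) \<le> norm x * K"
    using bounded_linear.bounded[OF bounded_clinear_bl[OF assms]] by blast
  then have "norm (T x - z *\<^sub>C x) \<le> norm x * (K + cmod z)" for x
    by (rule order_trans[OF norm_triangle_ineq4, OF order_trans[OF add_mono]])
      (auto simp: algebra_simps)
  then show ?thesis
    unfolding shifted_def
    by (intro bounded_clinearI)
      (auto simp: bounded_clinear_simps[OF assms] ell2.scale_right_diff_distrib
        ell2.scale_right_distrib ell2.scale_left_commute)
qed

lemma not_in_spectrumI:
  assumes T: "bounded_clinear T" and "c > 0" and c: "\<And>x. c * norm x \<le> norm (shifted T z x)"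
    and surj: "surj (shifted T z)"
  shows "z \<notin> spectrum T"
proof -
  define A where "A = shifted T z"
  have A: "bounded_clinear A" unfolding A_def by (rule bounded_clinear_shifted[OF T])
  have "x = y" if "A x = A y" for x y
  proof -
    have "c * norm (x - y) \<le> 0" using c[of "x - y"] that by (simp add: A_def[symmetric] bounded_clinear_diff[OF A])
    then show ?thesis using \<open>c > 0\<close> by (simp add: mult_le_0_iff)
  qed
  then have "inj A" by (rule injI)
  define S where "S = inv A"
  have SA: "S (A x) = x" for x using \<open>inj A\<close> by (simp add: S_def)
  have AS: "A (S x) = x" for x using surj by (simp add: S_def A_def surj_f_inv_f)
  have "bounded_clinear S"
  proof (rule bounded_clinearI)
    show "S (x + y) = S x + S y" for x y by (metis SA AS bounded_clinear_add[OF A])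
    show "S (a *\<^sub>C x) = a *\<^sub>C S x" for a x by (metis SA AS bounded_clinear_scaleC[OF A])
    show "norm (S x) \<le> norm x * (1/c)" for x
      using c[of "S x"] AS[of x] \<open>c > 0\<close> by (simp add: A_def field_simps)
  qed
  moreover have "S \<circ> A = id" "A \<circ> S = id" using SA AS by auto
  ultimately show ?thesis unfolding spectrum_def A_def by blast
qed

lemma not_in_spectrumD:
  assumes "z \<notin> spectrum T"
  obtains c where "c > 0" "\<And>x. c * norm x \<le> norm (shifted T z x)"
proof -
  from assms obtain S where S: "bounded_clinear S" "S \<circ> shifted T z = id"
    unfolding spectrum_def by blast
  obtain K where K: "K > 0" "\<And>x. norm (S x) \<le> norm x * K"
    using bounded_linear.pos_bounded[OF bounded_clinear_bl[OF S(1)]] by blast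
  have "1/K * norm x \<le> norm (shifted T z x)" for x
    using K(2)[of "shifted T z x"] K(1) S(2) by (simp add: fun_eq_iff field_simps)
  then show ?thesis using that[of "1/K"] K(1) by simp
qed

text \<open>Unitary means surjective and isometric here, so no adjoint has to be introduced;
  \<open>inv U\<close> plays its role.\<close>

definition unitary_op :: "('i ell2 \<Rightarrow> 'i ell2) \<Rightarrow> bool" where
  "unitary_op U \<longleftrightarrow> bounded_clinear U \<and> (\<forall>x. norm (U x) = norm x) \<and> surj U"

lemma unitary_op_compose: "unitary_op U \<Longrightarrow> unitary_op V \<Longrightarrow> unitary_op (U \<circ> V)"
  unfolding unitary_op_def using comp_surj[of V U] by (auto simp: bounded_clinear_compose)

text \<open>\<open>inner\<close> is only the real part of the Hermitian product, yet the adjoint of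
  a complex scalar with respect to it is still the conjugate scalar.\<close>

lemma inner_scaleC_ell2: "inner (c *\<^sub>C x) y = inner x (cnj c *\<^sub>C y)"
  unfolding inner_ell2_def by (rule infsum_cong) (simp add: inner_complex_def algebra_simps)

context
  fixes U :: "'i ell2 \<Rightarrow> 'i ell2"
  assumes U: "unitary_op U"
begin

lemma unitary_bcl: "bounded_clinear U" and unitary_norm: "norm (U x) = norm x"
  and unitary_surj: "surj U"
  using U by (auto simp: unitary_op_def)

lemma unitary_inv: "U (inv U x) = x"
  by (rule surj_f_inv_f[OF unitary_surj])

lemma unitary_inj: "inj U"
proof (rule injI)
  fix x y assume "U x = U y"
  then have "norm (U (x - y)) = 0" by (simp add: bounded_clinear_diff[OF unitary_bcl])
  then show "x = y" by (simp add: unitary_norm)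
qed

lemma unitary_inv_left: "inv U (U x) = x"
  by (rule inv_f_f[OF unitary_inj])

lemma unitary_op_inv: "unitary_op (inv U)"
proof -
  have n: "norm (inv U x) = norm x" for x using unitary_norm[of "inv U x"] unitary_inv by simp
  have "bounded_clinear (inv U)"
  proof (rule bounded_clinearI)
    show "inv U (x + y) = inv U x + inv U y" for x y
      by (metis unitary_inv unitary_inv_left bounded_clinear_add[OF unitary_bcl])
    show "inv U (a *\<^sub>C x) = a *\<^sub>C inv U x" for a x
      by (metis unitary_inv unitary_inv_left bounded_clinear_scaleC[OF unitary_bcl])
    show "norm (inv U x) \<le> norm x * 1" for x by (simp add: n)
  qed
  then show ?thesis using n unitary_inj by (auto simp: unitary_op_def inj_imp_surj_inv)
qed

lemma unitary_inner: "inner (U x) (U y) = inner x y"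
  by (simp add: dot_norm flip: bounded_clinear_add[OF unitary_bcl]) (simp add: unitary_norm)

lemma unitary_shifted_norm_ge: "\<bar>1 - cmod z\<bar> * norm x \<le> norm (shifted U z x)"
proof -
  have "\<bar>norm (U x) - norm (z *\<^sub>C x)\<bar> \<le> norm (shifted U z x)"
    unfolding shifted_def by (rule norm_triangle_ineq3)
  moreover have "norm (U x) - norm (z *\<^sub>C x) = (1 - cmod z) * norm x"
    by (simp add: unitary_norm algebra_simps)
  ultimately show ?thesis by (simp add: abs_mult)
qed

text \<open>The equation \<open>U x - z x = y\<close> is a fixed point equation for a contraction:
  outside the disc it is solved for the term \<open>z x\<close>, with factor
  \<open>1 / cmod z\<close>, and inside for the term \<open>U x\<close>, with factor
  \<open>cmod z\<close>.\<close>

lemma unitary_surj_off_circle: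
  assumes "cmod z \<noteq> 1"
  shows "surj (shifted U z)"
proof -
  have "\<exists>x. shifted U z x = y" for y
  proof (cases "cmod z > 1")
    case True
    define G where "G x = (1/z) *\<^sub>C (U x - y)" for x
    have "dist (G a) (G b) \<le> 1 / cmod z * dist a b" for a b
      using unitary_norm[of "a - b"]
      by (simp add: G_def dist_norm norm_divide bounded_clinear_diff[OF unitary_bcl]
          flip: ell2.scale_right_diff_distrib)
    then have "\<exists>!x. G x = x"
      using True by (intro banach_fix_type[of "1 / cmod z"]) (auto simp: divide_less_eq)
    then obtain x where "G x = x" by blast
    then have "z *\<^sub>C x = z *\<^sub>C G x" by simp
    also have "\<dots> = U x - y" using True by (auto simp: G_def)
    finally show ?thesis by (auto simp: shifted_def algebra_simps intro!: exI[of _ x])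
  next
    case False
    then have z: "cmod z < 1" using assms by simp
    define G where "G x = inv U (y + z *\<^sub>C x)" for x
    have "dist (G a) (G b) \<le> cmod z * dist a b" for a b
    proof -
      have "G a - G b = inv U (z *\<^sub>C (a - b))"
        using unitary_op_inv by (simp add: G_def unitary_op_def bounded_clinear_simps
            ell2.scale_right_diff_distrib)
      then show ?thesis using unitary_op_inv by (simp add: dist_norm unitary_op_def)
    qed
    with z obtain x where "G x = x"
      using banach_fix_type[of "cmod z" G] by auto
    then have "U x = U (G x)" by simp
    also have "\<dots> = y + z *\<^sub>C x" by (simp add: G_def unitary_inv)
    finally show ?thesis by (auto simp: shifted_def intro!: exI[of _ x])
  qed
  then show ?thesis by (metis surjI)
qed

text \<open>
  A point of the circle at which \<open>U - z\<close> is bounded below is joined to a resolvent point \<open>w\<close>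
  outside the disc, and \<open>U - z\<close> is inverted by perturbing \<open>U - w\<close>.
\<close>

lemma unitary_surj_if_bounded_below:
  assumes "c > 0" and c: "\<And>x. c * norm x \<le> norm (shifted U z x)"
  shows "surj (shifted U z)"
proof (cases "cmod z = 1")
  case False then show ?thesis by (rule unitary_surj_off_circle)
next
  case True
  \<comment> \<open>Moving by \<open>c/4\<close> leaves the lower bound \<open>3/4 * c\<close> at
    \<open>w\<close>. The perturbation \<open>w - z\<close> then acts with contraction factor
    \<open>(c/4) / (3/4 * c) = 1/3\<close>.\<close>
  define w where "w = of_real (1 + c/4) * z"
  have wz: "w - z = of_real (c/4) * z" by (simp add: w_def algebra_simps)
  have cwz: "cmod (w - z) = c/4" unfolding wz norm_mult using True \<open>c > 0\<close> by simp
  have "cmod w = 1 + c/4"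
    unfolding w_def norm_mult norm_of_real using True \<open>c > 0\<close> by simp
  then have "cmod w \<noteq> 1" using \<open>c > 0\<close> by simp
  then have surj: "surj (shifted U w)" by (rule unitary_surj_off_circle)
  define A where "A = shifted U w"
  have A: "bounded_clinear A" unfolding A_def by (rule bounded_clinear_shifted[OF unitary_bcl])
  define R where "R = inv A"
  have AR: "A (R x) = x" for x using surj by (simp add: R_def A_def surj_f_inv_f)
  have zw: "shifted U z x = A x + (w - z) *\<^sub>C x" for x
    by (simp add: A_def shifted_def ell2.scale_left_diff_distrib)
  have low: "3/4*c * norm x \<le> norm (A x)" for x
  proof -
    have "c * norm x \<le> norm (A x) + c/4 * norm x"
      using c[of x] norm_triangle_ineq[of "A x" "(w - z) *\<^sub>C x"] by (simp add: zw cwz)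
    then show ?thesis by simp
  qed
  have "\<exists>x. shifted U z x = y" for y
  proof -
    define G where "G x = R (y - (w - z) *\<^sub>C x)" for x
    have "dist (G a) (G b) \<le> 1/3 * dist a b" for a b
    proof -
      have "3/4*c * norm (G a - G b) \<le> norm (A (G a - G b))" by (rule low)
      also have "A (G a - G b) = (w - z) *\<^sub>C (b - a)"
        by (simp add: G_def AR bounded_clinear_diff[OF A] ell2.scale_right_diff_distrib)
      also have "norm \<dots> = c/4 * norm (a - b)" by (simp add: cwz norm_minus_commute)
      finally show ?thesis using \<open>c > 0\<close> by (simp add: dist_norm)
    qed
    then obtain x where "G x = x"
      using banach_fix_type[of "1/3" G] by auto
    then have "A x = A (G x)" by simp
    also have "\<dots> = y - (w - z) *\<^sub>C x" by (simp add: G_def AR)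
    finally show ?thesis by (auto simp: zw intro!: exI[of _ x])
  qed
  then show ?thesis by (metis surjI)
qed

text \<open>A unitary operator has no residual spectrum, so lower bounds alone decide membership.
  Spectra are accessed below only through approximate eigenvectors.\<close>

lemma unitary_not_in_spectrum_iff:
  "z \<notin> spectrum U \<longleftrightarrow> (\<exists>c>0. \<forall>x. c * norm x \<le> norm (shifted U z x))"
  by (meson not_in_spectrumD not_in_spectrumI unitary_bcl unitary_surj_if_bounded_below)

text \<open>
  Let \<open>d\<close> be the infimum of \<open>\<parallel>(U - z) x\<parallel>\<close> over unit vectors. The form of
  \<open>Q = (U - z)\<^sup>* (U - z) - d\<^sup>2\<close> is nonnegative and almost vanishes at almost minimizing \<open>x\<close>, hence so
  does \<open>Q x\<close>. Up to a unitary factor, \<open>Q = (U - z e\<^sup>i\<^sup>\<phi>) (U - z e\<^sup>-\<^sup>i\<^sup>\<phi>)\<close> with \<open>cos \<phi> = 1 - d\<^sup>2 / 2\<close>, so one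
  of these two points, both at distance \<open>d\<close> from \<open>z\<close>, is in the spectrum.
\<close>

lemma unitary_spectrum_near:
  assumes z: "cmod z = 1" and x0: "x0 \<noteq> 0" "norm (shifted U z x0) \<le> \<delta> * norm x0"
  shows "\<exists>w\<in>spectrum U. cmod (w - z) \<le> \<delta>"
proof -
  define A where "A = shifted U z"
  have A: "bounded_clinear A" unfolding A_def by (rule bounded_clinear_shifted[OF unitary_bcl])
  define V where "V = inv U"
  have V: "unitary_op V" unfolding V_def by (rule unitary_op_inv)
  then have Vl: "bounded_clinear V" and Vn: "norm (V x) = norm x" for x
    by (auto simp: unitary_op_def)
  have UV: "U (V x) = x" and VU: "V (U x) = x" for x
    by (simp_all add: V_def unitary_inv unitary_inv_left)
  define N where "N = (\<lambda>x. norm (A x)) ` {x. norm x = 1}"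
  define d where "d = Inf N"
  have bdd: "bdd_below N" by (auto simp: N_def intro!: bdd_belowI[of _ 0])
  have ne: "N \<noteq> {}" using x0(1) by (auto simp: N_def intro!: exI[of _ "sgn x0"] simp: norm_sgn)
  have d_le: "d * norm x \<le> norm (A x)" for x
  proof (cases "x = 0")
    case False
    then have "norm (A (of_real (1 / norm x) *\<^sub>C x)) \<in> N"
      unfolding N_def by (intro imageI) (simp add: norm_divide)
    then have "d \<le> norm (A (of_real (1 / norm x) *\<^sub>C x))"
      unfolding d_def using bdd by (rule cInf_lower)
    then show ?thesis using False by (simp add: bounded_clinear_scaleC[OF A] norm_divide field_simps)
  qed simp
  have d0: "d \<ge> 0" unfolding d_def using ne by (intro cInf_greatest) (auto simp: N_def)
  have nA: "norm (A x) \<le> 2 * norm x" for x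
    unfolding A_def shifted_def
    using norm_triangle_ineq4[of "U x" "z *\<^sub>C x"] by (simp add: z unitary_norm)
  have d2: "d \<le> 2"
  proof -
    have "d * norm x0 \<le> 2 * norm x0" using d_le[of x0] nA[of x0] by linarith
    then show ?thesis using x0(1) by simp
  qed
  \<comment> \<open>\<open>V\<close> is the adjoint of \<open>U\<close>, so the bracket is the
    adjoint of \<open>A\<close> applied to \<open>A x\<close>.\<close>
  define Q where "Q x = (V (A x) - cnj z *\<^sub>C A x) - of_real (d\<^sup>2) *\<^sub>C x" for x
  have Qform: "inner (Q x) y = inner (A x) (A y) - d\<^sup>2 * inner x y" for x y
  proof -
    have "inner (V (A x)) y = inner (A x) (U y)"
      using unitary_inner[of "V (A x)" y] by (simp add: UV)
    moreover have "inner (cnj z *\<^sub>C A x) y = inner (A x) (z *\<^sub>C y)"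
      by (subst inner_scaleC_ell2) simp
    ultimately have "inner (V (A x) - cnj z *\<^sub>C A x) y = inner (A x) (A y)"
      by (simp add: inner_diff_left inner_diff_right A_def shifted_def)
    then show ?thesis
      unfolding Q_def by (simp add: inner_diff_left flip: scaleR_ell2_eq_scaleC del: of_real_power)
  qed
  have nQ: "norm (Q x) \<le> 8 * norm x" for x
  proof -
    have "norm (Q x) \<le> norm (A x) + norm (A x) + d\<^sup>2 * norm x"
      unfolding Q_def using z
      by (intro order_trans[OF norm_triangle_ineq4] add_mono) (auto simp: Vn norm_power)
    also have "\<dots> \<le> 2 * norm x + 2 * norm x + 2\<^sup>2 * norm x"
      by (intro add_mono nA mult_right_mono power_mono d2 d0) auto
    finally show ?thesis by simp
  qed
  have Qpos: "0 \<le> inner (Q x) x" for x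
  proof -
    have "(d * norm x)\<^sup>2 \<le> (norm (A x))\<^sup>2" using d_le d0 by (intro power_mono) auto
    then show ?thesis unfolding Qform by (simp add: power_mult_distrib flip: power2_norm_eq_inner)
  qed
  have Qsym: "inner (Q x) y = inner (Q y) x" for x y
    unfolding Qform by (simp add: inner_commute)
  have Qle: "(norm (Q x))\<^sup>2 \<le> 8 * inner (Q x) x" for x
  proof -
    define y where "y = Q x"
    \<comment> \<open>The nonnegative form is evaluated at \<open>x - s Q x\<close>. With the bound
      8 on \<open>Q\<close> the result is at most
      \<open>inner (Q x) x - (2 s - 8 s^2) (norm (Q x))^2\<close>, and \<open>s = 1/8\<close> is the
      best choice.\<close>
    have bil: "inner (Q (x - (1/8) *\<^sub>R y)) (x - (1/8) *\<^sub>R y)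
        = inner (Q x) x - 1/4 * inner (Q x) y + 1/64 * inner (Q y) y"
    proof -
      define v where "v = x - (1/8) *\<^sub>R y"
      have v: "inner u v = inner u x - 1/8 * inner u y" for u by (simp add: v_def inner_diff_right)
      have "inner (Q v) v = inner (Q x) v - 1/8 * inner (Q y) v"
        by (subst v) (simp only: Qsym[of v])
      then show ?thesis unfolding v_def[symmetric] using v[of "Q x"] v[of "Q y"] Qsym[of y x] by linarith
    qed
    have "inner (Q y) y \<le> norm (Q y) * norm y" by (rule norm_cauchy_schwarz)
    also have "\<dots> \<le> (8 * norm y) * norm y" by (intro mult_right_mono nQ) auto
    finally have "inner (Q y) y \<le> 8 * (norm y)\<^sup>2" by (simp add: power2_eq_square)
    moreover have "inner (Q x) y = (norm y)\<^sup>2" by (simp add: y_def power2_norm_eq_inner)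
    ultimately show ?thesis using Qpos[of "x - (1/8) *\<^sub>R y"] unfolding bil unfolding y_def by linarith
  qed
  \<comment> \<open>The chord condition \<open>2 - 2 cos \<phi> = d^2\<close> puts both points of
    the circle at distance \<open>d\<close> from \<open>z\<close>; \<open>d \<le> 2\<close> keeps
    the argument of \<open>arccos\<close> in range.\<close>
  define \<phi> where "\<phi> = arccos (1 - d\<^sup>2 / 2)"
  have "d\<^sup>2 \<le> 2\<^sup>2" using d2 d0 by (rule power_mono)
  then have cos: "cos \<phi> = 1 - d\<^sup>2 / 2" unfolding \<phi>_def by (intro cos_arccos) auto
  define w where "w s = z * cis (s * \<phi>)" for s :: real
  have dist_w: "cmod (w s - z) = d" if "s\<^sup>2 = 1" for s
  proof -
    have s: "s = 1 \<or> s = -1" using that by (simp add: power2_eq_1_iff)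
    have "w s - z = z * (cis (s * \<phi>) - 1)" by (simp add: w_def algebra_simps)
    then have "(cmod (w s - z))\<^sup>2 = (cmod (cis (s * \<phi>) - 1))\<^sup>2" by (simp add: norm_mult z)
    also have "\<dots> = (cos \<phi> - 1)\<^sup>2 + (sin \<phi>)\<^sup>2"
      using s by (auto simp: cmod_power2)
    also have "\<dots> = 2 - 2 * cos \<phi>"
      using sin_cos_squared_add[of \<phi>] by (simp add: power2_eq_square algebra_simps)
    also have "\<dots> = d\<^sup>2" by (simp add: cos)
    finally show ?thesis using d0 by (simp add: power2_eq_iff_nonneg)
  qed
  have zz: "cnj z * z = 1" using z by (simp add: complex_norm_square[symmetric] mult.commute)
  \<comment> \<open>Expanded, \<open>Q x = (2 - d^2) x - z V x - cnj z U x\<close>. Applying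
    \<open>- z U\<close>, which preserves norms, gives the monic quadratic polynomial in
    \<open>U\<close> with roots \<open>w 1\<close> and \<open>w (-1)\<close>.\<close>
  have factor: "norm (Q x) = norm (shifted U (w 1) (shifted U (w (-1)) x))" for x
  proof -
    have sum: "w 1 + w (-1) = of_real (2 - d\<^sup>2) * z"
    proof -
      have "2 - d\<^sup>2 = 2 * cos \<phi>" using cos by simp
      then show ?thesis by (simp only: w_def) (auto simp: complex_eq_iff algebra_simps)
    qed
    have prod: "w 1 * w (-1) = z * z" by (simp add: w_def cis_mult)
    define F where "F = U (U x) - (w 1 + w (-1)) *\<^sub>C U x + (w 1 * w (-1)) *\<^sub>C x"
    have F: "shifted U (w 1) (shifted U (w (-1)) x) = F"
      by (simp add: F_def shifted_def bounded_clinear_simps[OF unitary_bcl]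
          ell2.scale_left_distrib ell2.scale_right_diff_distrib algebra_simps)
    have "V F = U x - (of_real (2 - d\<^sup>2) * z) *\<^sub>C x + (z * z) *\<^sub>C V x"
      by (simp only: F_def sum prod bounded_clinear_simps[OF Vl] VU)
    then have "cnj z *\<^sub>C V F = cnj z *\<^sub>C U x - (cnj z * (of_real (2 - d\<^sup>2) * z)) *\<^sub>C x
        + (cnj z * (z * z)) *\<^sub>C V x"
      by (simp only: ell2.scale_right_distrib ell2.scale_right_diff_distrib ell2.scale_scale)
    also have "cnj z * (of_real (2 - d\<^sup>2) * z) = of_real (2 - d\<^sup>2)"
      using zz by (simp only: mult.left_commute[of "cnj z"]) simp
    also have "cnj z * (z * z) = z" using zz by (simp add: mult.assoc[symmetric])
    finally have 1: "cnj z *\<^sub>C V F = cnj z *\<^sub>C U x - of_real (2 - d\<^sup>2) *\<^sub>C x + z *\<^sub>C V x" .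
    have "Q x = x - z *\<^sub>C V x - (cnj z *\<^sub>C U x - x) - of_real (d\<^sup>2) *\<^sub>C x"
      unfolding Q_def A_def shifted_def
      by (simp only: bounded_clinear_simps[OF Vl] VU ell2.scale_right_diff_distrib
          ell2.scale_scale zz ell2.scale_one)
    also have "\<dots> = - (cnj z *\<^sub>C V F)"
      unfolding 1 by (rule ell2_eqI) (simp add: algebra_simps)
    finally have "norm (Q x) = norm (cnj z *\<^sub>C V F)" by simp
    then show ?thesis by (simp add: F Vn z)
  qed
  have "w 1 \<in> spectrum U \<or> w (-1) \<in> spectrum U"
  proof (rule ccontr)
    assume "\<not> ?thesis"
    then obtain a b where ab: "a > 0" "b > 0" "\<And>x. a * norm x \<le> norm (shifted U (w 1) x)"
      "\<And>x. b * norm x \<le> norm (shifted U (w (-1)) x)"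
      unfolding unitary_not_in_spectrum_iff de_Morgan_disj by blast
    \<comment> \<open>With this \<open>e\<close>, almost minimality gives
      \<open>(norm (Q x))^2 < 8 e = (a b)^2 / 2\<close>, against the lower bound
      \<open>(a b)^2\<close> from the two factors.\<close>
    define e where "e = (a * b)\<^sup>2 / 16"
    have "e > 0" using ab by (simp add: e_def)
    then have "d < sqrt (d\<^sup>2 + e)" using d0 real_less_rsqrt by simp
    then obtain x where x: "norm x = 1" "norm (A x) < sqrt (d\<^sup>2 + e)"
      unfolding d_def using cInf_lessD[OF ne] by (auto simp: N_def)
    have "(norm (A x))\<^sup>2 < (sqrt (d\<^sup>2 + e))\<^sup>2"
      using x(2) by (intro power_strict_mono) auto
    then have "(norm (A x))\<^sup>2 < d\<^sup>2 + e" using \<open>e > 0\<close> by simp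
    then have "inner (Q x) x < e"
      unfolding Qform using x(1) by (simp flip: power2_norm_eq_inner)
    then have "(norm (Q x))\<^sup>2 < 8 * e" using Qle[of x] by linarith
    moreover have "a * b \<le> norm (Q x)"
    proof -
      have "a * b \<le> a * norm (shifted U (w (-1)) x)"
        using ab(4)[of x] ab(1) x(1) by (intro mult_left_mono) auto
      also have "\<dots> \<le> norm (Q x)" unfolding factor by (rule ab(3))
      finally show ?thesis .
    qed
    then have "(a * b)\<^sup>2 \<le> (norm (Q x))\<^sup>2" using ab by (intro power_mono) auto
    ultimately show False using ab \<open>e > 0\<close> unfolding e_def by linarith
  qed
  moreover have "d \<le> \<delta>"
  proof -
    have "d * norm x0 \<le> \<delta> * norm x0" using d_le[of x0] x0(2) by (simp add: A_def)
    then show ?thesis using x0(1) by simp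
  qed
  moreover have "cmod (w 1 - z) = d" "cmod (w (-1) - z) = d" using dist_w by simp_all
  ultimately show ?thesis by metis
qed

end

section \<open>Sums of two-dimensional blocks\<close>

definition rho :: "complex \<Rightarrow> complex" where
  "rho a = complex_of_real (sqrt (1 - (cmod a)\<^sup>2))"

lemma rho_cnj [simp]: "rho (cnj a) = rho a" "cnj (rho a) = rho a"
  by (simp_all add: rho_def)

lemma rho_sq: "cmod a \<le> 1 \<Longrightarrow> rho a * rho a = 1 - a * cnj a"
  by (simp add: rho_def power_le_one flip: of_real_mult complex_norm_square)

lemma cmod_rho_le: "cmod a \<le> 1 \<Longrightarrow> cmod (rho a) \<le> 1"
  by (simp add: rho_def power_le_one)

lemma tendsto_rho: "(f \<longlongrightarrow> a) F \<Longrightarrow> ((\<lambda>x. rho (f x)) \<longlongrightarrow> rho a) F"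
  unfolding rho_def by (intro tendsto_intros)

text \<open>
  The cases \<open>p = 0\<close> and \<open>p = 1\<close> are the two factors of the CMV matrix. Translation by \<open>a\<close> replaces
  \<open>p\<close> by \<open>p + a\<close>, so an odd translation exchanges them.
\<close>

definition blk :: "int \<Rightarrow> (int \<Rightarrow> complex) \<Rightarrow> int ell2 \<Rightarrow> int ell2" where
  "blk p \<beta> x = Abs_ell2 (\<lambda>n.
     if even (n + p) then cnj (\<beta> n) * ell2_nth x n + rho (\<beta> n) * ell2_nth x (n + 1)
     else rho (\<beta> (n - 1)) * ell2_nth x (n - 1) - \<beta> (n - 1) * ell2_nth x n)"

definition shift :: "int \<Rightarrow> int ell2 \<Rightarrow> int ell2" where
  "shift a x = Abs_ell2 (\<lambda>n. ell2_nth x (n - a))"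

lemma infsum_reindex_int:
  fixes s :: "int \<Rightarrow> int"
  assumes "\<And>n. t (s n) = n" "\<And>n. s (t n) = n"
  shows "(\<Sum>\<^sub>\<infinity>n. f (s n)) = infsum f UNIV"
    and "f summable_on UNIV \<Longrightarrow> (\<lambda>n. f (s n)) summable_on UNIV"
proof -
  have b: "bij_betw s UNIV UNIV" by (rule bij_betwI[of _ _ _ t]) (use assms in auto)
  show "(\<Sum>\<^sub>\<infinity>n. f (s n)) = infsum f UNIV" by (rule infsum_reindex_bij_betw[OF b])
  show "f summable_on UNIV \<Longrightarrow> (\<lambda>n. f (s n)) summable_on UNIV"
    by (simp add: summable_on_reindex_bij_betw[OF b])
qed

lemma ell2_nth_shift [simp]: "ell2_nth (shift a x) n = ell2_nth x (n - a)"
  unfolding shift_def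
  by (subst ell2_nth_Abs[OF infsum_reindex_int(2)[OF _ _ ell2_nth_summable[of x]],
        of "\<lambda>n. n + a" "\<lambda>n. n - a"]) auto

lemma norm_shift [simp]: "norm (shift a x) = norm x"
  using infsum_reindex_int(1)[of "\<lambda>n. n + a" "\<lambda>n. n - a" "\<lambda>n. (cmod (ell2_nth x n))\<^sup>2"]
  by (simp add: norm_ell2_eq)

lemma Theta_unitary:
  assumes "cmod a \<le> 1"
  shows "(cmod (cnj a * u + rho a * v))\<^sup>2 + (cmod (rho a * u - a * v))\<^sup>2 = (cmod u)\<^sup>2 + (cmod v)\<^sup>2"
proof -
  have r: "rho a * rho a = 1 - a * cnj a" using assms by (rule rho_sq)
  have "(cnj a * u + rho a * v) * cnj (cnj a * u + rho a * v)
      + (rho a * u - a * v) * cnj (rho a * u - a * v)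
      = (a * cnj a + rho a * rho a) * (u * cnj u + v * cnj v)"
    by (simp add: algebra_simps)
  also have "\<dots> = u * cnj u + v * cnj v" by (simp add: r)
  finally have "complex_of_real ((cmod (cnj a * u + rho a * v))\<^sup>2 + (cmod (rho a * u - a * v))\<^sup>2)
      = complex_of_real ((cmod u)\<^sup>2 + (cmod v)\<^sup>2)"
    by (simp only: of_real_add complex_norm_square)
  then show ?thesis by (simp only: of_real_eq_iff)
qed

context
  fixes \<beta> :: "int \<Rightarrow> complex"
  assumes \<beta>: "\<And>n. cmod (\<beta> n) \<le> 1"
begin

lemma ell2_nth_blk: "ell2_nth (blk p \<beta> x) n =
    (if even (n + p) then cnj (\<beta> n) * ell2_nth x n + rho (\<beta> n) * ell2_nth x (n + 1)
     else rho (\<beta> (n - 1)) * ell2_nth x (n - 1) - \<beta> (n - 1) * ell2_nth x n)"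
proof -
  let ?s = "\<lambda>n. (cmod (ell2_nth x n))\<^sup>2"
  have le: "(cmod (c * u + d * v))\<^sup>2 \<le> 2 * ((cmod u)\<^sup>2 + (cmod v)\<^sup>2)"
    if "cmod c \<le> 1" "cmod d \<le> 1" for c d u v
  proof -
    have "(cmod (c * u))\<^sup>2 \<le> (cmod u)\<^sup>2" "(cmod (d * v))\<^sup>2 \<le> (cmod v)\<^sup>2"
      using that by (auto simp only: norm_mult intro!: power_mono mult_left_le_one_le
          mult_nonneg_nonneg norm_ge_zero)
    then have "2 * ((cmod (c * u))\<^sup>2 + (cmod (d * v))\<^sup>2) \<le> 2 * ((cmod u)\<^sup>2 + (cmod v)\<^sup>2)"
      by (intro mult_left_mono add_mono) simp_all
    with cmod_add_sq_le show ?thesis by (rule order_trans)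
  qed
  have "(cmod (cnj (\<beta> n) * ell2_nth x n + rho (\<beta> n) * ell2_nth x (n + 1)))\<^sup>2
      \<le> 2 * (?s (n - 1) + ?s n + ?s (n + 1))" for n
    by (rule order_trans[OF le]) (use \<beta> in \<open>auto simp: cmod_rho_le\<close>)
  moreover have "(cmod (rho (\<beta> (n - 1)) * ell2_nth x (n - 1) - \<beta> (n - 1) * ell2_nth x n))\<^sup>2
      \<le> 2 * (?s (n - 1) + ?s n + ?s (n + 1))" for n
  proof -
    have "(cmod (rho (\<beta> (n - 1)) * ell2_nth x (n - 1) + (- \<beta> (n - 1)) * ell2_nth x n))\<^sup>2
        \<le> 2 * (?s (n - 1) + ?s n + ?s (n + 1))"
      by (rule order_trans[OF le]) (use \<beta> in \<open>auto simp: cmod_rho_le\<close>)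
    then show ?thesis by simp
  qed
  ultimately show ?thesis
    unfolding blk_def by (subst ell2_nth_Abs[OF ell2_neighbour_summable(2)[of x]]) auto
qed

lemma norm_blk: "norm (blk p \<beta> x) = norm x"
proof -
  \<comment> \<open>\<open>s\<close> is the involution exchanging the two sites of a block. Summing
    \<open>f n + f (s n)\<close> over all sites counts everything twice, which avoids enumerating
    the blocks.\<close>
  define s where "s n = (if even (n + p) then n + 1 else n - 1)" for n
  have ss: "s (s n) = n" for n by (auto simp: s_def)
  define g h where "g n = (cmod (ell2_nth (blk p \<beta> x) n))\<^sup>2" and "h n = (cmod (ell2_nth x n))\<^sup>2" for n
  have gh: "g n + g (s n) = h n + h (s n)" for n
    using Theta_unitary[OF \<beta>, of n "ell2_nth x n" "ell2_nth x (n + 1)"]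
      Theta_unitary[OF \<beta>, of "n - 1" "ell2_nth x (n - 1)" "ell2_nth x n"]
    by (cases "even (n + p)") (auto simp: g_def h_def s_def ell2_nth_blk)
  have sm: "g summable_on UNIV" "h summable_on UNIV"
    unfolding g_def h_def by (rule ell2_nth_summable)+
  have "2 * infsum f UNIV = (\<Sum>\<^sub>\<infinity>n. f n + f (s n))" if "f summable_on UNIV" for f :: "int \<Rightarrow> real"
    using infsum_reindex_int[of s s f] ss that by (simp add: infsum_add)
  from this[OF sm(1)] this[OF sm(2)] have "infsum g UNIV = infsum h UNIV"
    by (simp add: gh)
  then show ?thesis unfolding norm_ell2_eq g_def h_def by simp
qed

lemma blk_bounded_clinear: "bounded_clinear (blk p \<beta>)"
  by (rule bounded_clinearI[where K=1]; (rule ell2_eqI)?) (auto simp: ell2_nth_blk norm_blk algebra_simps)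

end

text \<open>\<open>Theta a\<close> is symmetric and unitary, so its inverse is its entrywise
  conjugate, which is \<open>Theta (cnj a)\<close>.\<close>

lemma blk_inverse:
  assumes \<beta>: "\<And>n. cmod (\<beta> n) \<le> 1"
  shows "blk p (\<lambda>n. cnj (\<beta> n)) (blk p \<beta> x) = x"
proof (rule ell2_eqI)
  fix n
  have r: "rho (\<beta> n) * rho (\<beta> n) = 1 - \<beta> n * cnj (\<beta> n)" for n using \<beta> by (rule rho_sq)
  show "ell2_nth (blk p (\<lambda>n. cnj (\<beta> n)) (blk p \<beta> x)) n = ell2_nth x n"
    by (auto simp: ell2_nth_blk \<beta> algebra_simps r)
qed

lemma blk_unitary:
  assumes "\<And>n. cmod (\<beta> n) \<le> 1"
  shows "unitary_op (blk p \<beta>)"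
proof -
  have "surj (blk p \<beta>)"
    using blk_inverse[of "\<lambda>n. cnj (\<beta> n)" p] assms by (intro surjI) auto
  then show ?thesis by (simp add: unitary_op_def blk_bounded_clinear norm_blk assms)
qed

lemma ext_CMV_eq:
  assumes "\<And>n. cmod (\<beta> n) \<le> 1"
  shows "ext_CMV \<beta> = blk 0 \<beta> \<circ> blk 1 \<beta>"
proof -
  have "ext_CMV_L \<beta> = blk 0 \<beta>" "ext_CMV_M \<beta> = blk 1 \<beta>"
    by (rule ext, rule ell2_eqI, simp add: ell2_nth_ext_CMV_L ell2_nth_ext_CMV_M
        ell2_nth_blk assms Theta_mult_vector rho_def)+
  then show ?thesis by (simp add: ext_CMV_def)
qed

lemma ext_CMV_unitary: "(\<And>n. cmod (\<beta> n) \<le> 1) \<Longrightarrow> unitary_op (ext_CMV \<beta>)"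
  by (simp add: ext_CMV_eq blk_unitary unitary_op_compose)

text \<open>
  With \<open>p = 0\<close> this is \<open>M - z L\<^sup>-\<^sup>1 = L\<^sup>-\<^sup>1 (L M - z)\<close>, with \<open>p = 1\<close> it is \<open>L - z M\<^sup>-\<^sup>1 = (L M - z) M\<^sup>-\<^sup>1\<close>.
  Unlike \<open>L M\<close>, these operators are tridiagonal.
\<close>

definition pencil :: "int \<Rightarrow> complex \<Rightarrow> (int \<Rightarrow> complex) \<Rightarrow> int ell2 \<Rightarrow> int ell2" where
  "pencil p z \<beta> x = blk (p + 1) \<beta> x - z *\<^sub>C blk p (\<lambda>n. cnj (\<beta> n)) x"

context
  fixes \<beta> :: "int \<Rightarrow> complex"
  assumes \<beta>: "\<And>n. cmod (\<beta> n) \<le> 1"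
begin

lemma ell2_nth_pencil: "ell2_nth (pencil p z \<beta> x) n =
    (if even (n + p)
     then rho (\<beta> (n - 1)) * ell2_nth x (n - 1) - (\<beta> (n - 1) + z * \<beta> n) * ell2_nth x n
       - z * rho (\<beta> n) * ell2_nth x (n + 1)
     else - z * rho (\<beta> (n - 1)) * ell2_nth x (n - 1)
       + (cnj (\<beta> n) + z * cnj (\<beta> (n - 1))) * ell2_nth x n + rho (\<beta> n) * ell2_nth x (n + 1))"
  by (simp add: pencil_def ell2_nth_blk \<beta> algebra_simps)

lemma pencil_bounded_clinear: "bounded_clinear (pencil p z \<beta>)"
proof -
  have 1: "bounded_clinear (blk p \<beta>)" "bounded_clinear (blk p (\<lambda>n. cnj (\<beta> n)))" for p
    by (intro blk_bounded_clinear; simp add: \<beta>)+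
  have "norm (pencil p z \<beta> x) \<le> norm x * (1 + cmod z)" for x
    unfolding pencil_def
    by (rule order_trans[OF norm_triangle_ineq4]) (simp add: norm_blk \<beta> algebra_simps)
  then show ?thesis
    by (intro bounded_clinearI[where K="1 + cmod z"]) (auto simp: pencil_def bounded_clinear_simps[OF 1(1)]
        bounded_clinear_simps[OF 1(2)] ell2.scale_left_commute ell2.scale_right_diff_distrib
        ell2.scale_right_distrib)
qed

lemma pencil_shift: "pencil p z \<beta> (shift a x) = shift a (pencil (p + a) z (\<lambda>n. \<beta> (n + a)) x)"
proof -
  have "blk p \<gamma> (shift a x) = shift a (blk (p + a) (\<lambda>n. \<gamma> (n + a)) x)"
    if \<gamma>: "\<And>n. cmod (\<gamma> n) \<le> 1" for \<gamma> p
  proof (rule ell2_eqI)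
    fix n
    have e: "n - a + (p + a) = n + p" "n - a + a = n" "n - a - 1 + a = n - 1" "n - a - 1 = n - 1 - a"
      "n - a + 1 = n + 1 - a" "n - 1 - a + a = n - 1" by simp_all
    show "ell2_nth (blk p \<gamma> (shift a x)) n = ell2_nth (shift a (blk (p + a) (\<lambda>n. \<gamma> (n + a)) x)) n"
      by (simp only: ell2_nth_blk \<gamma> ell2_nth_shift e)
  qed
  from this[of \<beta> "p + 1"] this[of "\<lambda>n. cnj (\<beta> n)" p] show ?thesis
    by (intro ell2_eqI) (simp add: pencil_def \<beta> add.assoc add.commute[of 1])
qed

lemma norm_pencil_even:
  assumes "even p"
  shows "norm (pencil p z \<beta> x) = norm (shifted (ext_CMV \<beta>) z x)"
proof -
  have p: "blk p = blk 0" "blk (p + 1) = blk 1" using assms by (intro ext; simp add: blk_def)+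
  have L: "bounded_clinear (blk 0 \<beta>)" by (rule blk_bounded_clinear[OF \<beta>])
  have "blk 0 \<beta> (pencil p z \<beta> x) = shifted (ext_CMV \<beta>) z x"
    using blk_inverse[of "\<lambda>n. cnj (\<beta> n)" 0 x] \<beta>
    by (simp add: pencil_def p bounded_clinear_simps[OF L] shifted_def ext_CMV_eq)
  moreover have "norm (blk 0 \<beta> (pencil p z \<beta> x)) = norm (pencil p z \<beta> x)"
    by (rule norm_blk) (rule \<beta>)
  ultimately show ?thesis by simp
qed

lemma norm_pencil_odd:
  assumes "odd p"
  shows "norm (pencil p z \<beta> (blk 1 \<beta> x)) = norm (shifted (ext_CMV \<beta>) z x)"
proof -
  have p: "blk p = blk 1" "blk (p + 1) = blk 0" using assms by (intro ext; simp add: blk_def)+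
  have "pencil p z \<beta> (blk 1 \<beta> x) = shifted (ext_CMV \<beta>) z x"
    using blk_inverse[of \<beta> 1 x] \<beta>
    by (simp add: pencil_def p shifted_def ext_CMV_eq)
  then show ?thesis by simp
qed

text \<open>Both parities of \<open>p\<close> are covered because translations by odd distances will
  occur. In the odd case the approximate eigenvector has to be replaced by its image under
  \<open>M\<close>.\<close>

lemma spectrum_pencil_approx:
  assumes "z \<in> spectrum (ext_CMV \<beta>)" "e > 0"
  shows "\<exists>x. norm (pencil p z \<beta> x) < e * norm x"
proof -
  have U: "unitary_op (ext_CMV \<beta>)" by (rule ext_CMV_unitary) (rule \<beta>)
  obtain x where x: "norm (shifted (ext_CMV \<beta>) z x) < e * norm x"
    using assms unitary_not_in_spectrum_iff[OF U, of z] by (auto simp: not_le)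
  show ?thesis
  proof (cases "even p")
    case True then show ?thesis using x by (auto simp: norm_pencil_even)
  next
    case False
    have "norm (pencil p z \<beta> (blk 1 \<beta> x)) < e * norm (blk 1 \<beta> x)"
      using x False by (simp add: norm_pencil_odd norm_blk[OF \<beta>])
    then show ?thesis by blast
  qed
qed

end

text \<open>The strict inequality is an open condition on \<open>x\<close>, and finitely supported
  vectors are dense.\<close>

lemma bounded_clinear_approx_finite_support:
  assumes T: "bounded_clinear T" and x: "norm (T x) < e * norm x"
  shows "\<exists>F. finite F \<and> norm (T (trunc F x)) < e * norm (trunc F x)"
proof -
  obtain K where K: "K > 0" "\<And>x. norm (T x) \<le> norm x * K"
    using bounded_linear.pos_bounded[OF bounded_clinear_bl[OF T]] by blast
  define g where "g = e * norm x - norm (T x)"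
  have "g > 0" using x by (simp add: g_def)
  \<comment> \<open>\<open>g\<close> is the slack in the inequality. Truncation costs at most
    \<open>d K\<close> on the left and \<open>\<bar>e\<bar> d\<close> on the right; the extra 1
    makes the total strictly smaller than \<open>g\<close>.\<close>
  define d where "d = g / (K + \<bar>e\<bar> + 1)"
  have "d > 0" using \<open>g > 0\<close> K(1) by (simp add: d_def)
  then obtain F where F: "finite F" "norm (x - trunc F x) < d" by (rule trunc_approx)
  define y where "y = trunc F x"
  have "norm (T y) \<le> norm (T x) + norm (T (x - y))"
    using norm_triangle_ineq4[of "T x" "T (x - y)"] by (simp add: bounded_clinear_diff[OF T])
  moreover have "norm (T (x - y)) \<le> d * K"
    using F(2) K(1) by (intro order_trans[OF K(2)] mult_right_mono) (auto simp: y_def)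
  moreover have "e * norm x \<le> e * norm y + \<bar>e\<bar> * d"
  proof -
    have "e * (norm x - norm y) \<le> \<bar>e\<bar> * \<bar>norm x - norm y\<bar>"
      using abs_ge_self[of "e * (norm x - norm y)"] by (simp only: abs_mult)
    also have "\<dots> \<le> \<bar>e\<bar> * d"
      using norm_triangle_ineq3[of x y] F(2) by (intro mult_left_mono) (auto simp: y_def)
    finally show ?thesis by (simp add: algebra_simps)
  qed
  moreover have "d * K + \<bar>e\<bar> * d < g"
  proof -
    have "d * K + \<bar>e\<bar> * d < d * (K + \<bar>e\<bar> + 1)" using \<open>d > 0\<close> by (simp add: algebra_simps)
    also have "\<dots> = g" using K(1) by (simp add: d_def)
    finally show ?thesis .
  qed
  ultimately have "norm (T y) < e * norm y" by (simp add: g_def)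
  then show ?thesis using F(1) by (auto simp: y_def)
qed

section \<open>The half-line matrix\<close>

definition emb :: "nat ell2 \<Rightarrow> int ell2" where
  "emb x = Abs_ell2 (\<lambda>n. if 0 \<le> n then ell2_nth x (nat n) else 0)"

lemma emb_summable:
  "(\<lambda>n. (cmod (if 0 \<le> n then ell2_nth x (nat n) else 0))\<^sup>2) summable_on (UNIV :: int set)" (is ?s)
  "(\<Sum>\<^sub>\<infinity>n::int. (cmod (if 0 \<le> n then ell2_nth x (nat n) else 0))\<^sup>2)
    = (\<Sum>\<^sub>\<infinity>n. (cmod (ell2_nth x n))\<^sup>2)" (is ?i)
proof -
  let ?f = "\<lambda>n::int. (cmod (if 0 \<le> n then ell2_nth x (nat n) else 0))\<^sup>2"
  have b: "bij_betw int UNIV {0..}" by (rule bij_betwI[of _ _ _ nat]) auto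
  have "?f summable_on {0..}"
    using summable_on_reindex_bij_betw[OF b, of ?f] ell2_nth_summable[of x] by simp
  then show ?s by (rule summable_on_cong_neutral[THEN iffD1, rotated -1]) auto
  have "infsum ?f UNIV = infsum ?f {0..}" by (rule infsum_cong_neutral) auto
  also have "\<dots> = (\<Sum>\<^sub>\<infinity>n. (cmod (ell2_nth x n))\<^sup>2)"
    using infsum_reindex_bij_betw[OF b, of ?f] by simp
  finally show ?i .
qed

lemma ell2_nth_emb [simp]: "ell2_nth (emb x) n = (if 0 \<le> n then ell2_nth x (nat n) else 0)"
  unfolding emb_def by (subst ell2_nth_Abs[OF emb_summable(1)[of x]]) auto

lemma norm_emb [simp]: "norm (emb x) = norm x"
  by (simp only: norm_ell2_eq ell2_nth_emb emb_summable(2))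

lemma emb_inject [simp]: "emb x = emb y \<longleftrightarrow> x = y"
proof
  assume e: "emb x = emb y"
  show "x = y"
  proof (rule ell2_eqI)
    fix n show "ell2_nth x n = ell2_nth y n"
      using arg_cong[OF e, of "\<lambda>u. ell2_nth u (int n)"] by simp
  qed
qed simp

lemma emb_simps: "emb (x + y) = emb x + emb y" "emb (x - y) = emb x - emb y"
  "emb (c *\<^sub>C x) = c *\<^sub>C emb x"
  by (rule ell2_eqI; simp)+

lemma emb_surj:
  assumes "\<And>n. n < 0 \<Longrightarrow> ell2_nth y n = 0"
  obtains x where "emb x = y"
proof -
  have "(\<lambda>n. (cmod (ell2_nth y n))\<^sup>2) summable_on range int"
    by (rule summable_on_subset_banach[OF ell2_nth_summable]) auto
  then have "(\<lambda>n. (cmod (ell2_nth y (int n)))\<^sup>2) summable_on UNIV"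
    by (subst (asm) summable_on_reindex) (auto simp: o_def)
  then have "ell2_nth (Abs_ell2 (\<lambda>n. ell2_nth y (int n))) = (\<lambda>n. ell2_nth y (int n))"
    by (simp add: Abs_ell2_inverse)
  then have "emb (Abs_ell2 (\<lambda>n. ell2_nth y (int n))) = y"
    by (intro ell2_eqI) (use assms in auto)
  then show ?thesis by (rule that)
qed

text \<open>
  With \<open>\<alpha>\<^sub>-\<^sub>1 = -1\<close> the two-sided matrix decouples at the origin, and its right half is the CMV matrix.
\<close>

definition extend :: "(nat \<Rightarrow> complex) \<Rightarrow> int \<Rightarrow> complex" where
  "extend \<alpha> n = (if n < 0 then -1 else \<alpha> (nat n))"

lemma extend_cnj: "extend (\<lambda>n. cnj (\<alpha> n)) = (\<lambda>n. cnj (extend \<alpha> n))"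
  by (auto simp: extend_def)

context
  fixes \<alpha> :: "nat \<Rightarrow> complex"
  assumes \<alpha>: "\<And>n. cmod (\<alpha> n) \<le> 1"
begin

lemma cmod_extend_le: "cmod (extend \<alpha> n) \<le> 1"
  by (simp add: extend_def \<alpha>)

lemma emb_CMV_L: "emb (CMV_L \<alpha> x) = blk 0 (extend \<alpha>) (emb x)"
proof (rule ell2_eqI)
  fix n :: int
  show "ell2_nth (emb (CMV_L \<alpha> x)) n = ell2_nth (blk 0 (extend \<alpha>) (emb x)) n"
  proof (cases "n < 0")
    case True
    \<comment> \<open>No block of \<open>L\<close> straddles the origin, so negative sites only see
      the zeros of \<open>emb x\<close>.\<close>
    then have "even n \<Longrightarrow> n + 1 < 0" by presburger
    with True show ?thesis by (auto simp: ell2_nth_blk cmod_extend_le)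
  next
    case False
    then obtain k where k: "n = int k" by (metis nonneg_int_cases not_less)
    have o: "odd k \<Longrightarrow> 1 \<le> k \<and> nat (int k - 1) = k - 1" by (cases k) auto
    show ?thesis
      using o by (auto simp: k ell2_nth_blk cmod_extend_le ell2_nth_CMV_L \<alpha> Theta_mult_vector
          rho_def extend_def nat_add_distrib)
  qed
qed

text \<open>The one block straddling the origin is \<open>Theta (-1)\<close>, the diagonal matrix
  with entries -1 and 1. Its second entry is the one-dimensional identity with which
  \<open>M\<close> begins.\<close>

lemma emb_CMV_M: "emb (CMV_M \<alpha> x) = blk 1 (extend \<alpha>) (emb x)"
proof (rule ell2_eqI)
  fix n :: int
  show "ell2_nth (emb (CMV_M \<alpha> x)) n = ell2_nth (blk 1 (extend \<alpha>) (emb x)) n"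
  proof (cases "n < 0")
    case True
    then show ?thesis by (auto simp: ell2_nth_blk \<alpha> extend_def rho_def)
  next
    case False
    then obtain k where k: "n = int k" by (metis nonneg_int_cases not_less)
    have o: "k \<noteq> 0 \<Longrightarrow> 1 \<le> k \<and> nat (int k - 1) = k - 1" by (cases k) auto
    show ?thesis
      using o by (cases "k = 0") (auto simp: k ell2_nth_blk cmod_extend_le ell2_nth_CMV_M \<alpha> Theta_mult_vector
          rho_def extend_def nat_add_distrib)
  qed
qed

lemma emb_CMV: "emb (CMV \<alpha> x) = ext_CMV (extend \<alpha>) (emb x)"
proof -
  have "ext_CMV (extend \<alpha>) = blk 0 (extend \<alpha>) \<circ> blk 1 (extend \<alpha>)"
    by (rule ext_CMV_eq) (rule cmod_extend_le)
  then show ?thesis by (simp add: CMV_def emb_CMV_L emb_CMV_M)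
qed

end

text \<open>Norms and linearity are inherited from the line through \<open>emb\<close>. Surjectivity
  does not restrict to a half-line automatically; it comes from the explicit inverse, the two
  factors with conjugate coefficients in reverse order.\<close>

lemma CMV_unitary:
  assumes \<alpha>: "\<And>n. cmod (\<alpha> n) \<le> 1"
  shows "unitary_op (CMV \<alpha>)"
proof -
  have U: "unitary_op (ext_CMV (extend \<alpha>))" by (intro ext_CMV_unitary cmod_extend_le \<alpha>)
  note e = emb_CMV[of \<alpha>, OF \<alpha>]
  have n: "norm (CMV \<alpha> x) = norm x" for x
    by (subst (1 2) norm_emb[symmetric]) (simp only: e unitary_norm[OF U])
  have "bounded_clinear (CMV \<alpha>)"
    by (rule bounded_clinearI[where K=1]; (subst emb_inject[symmetric])?)
      (simp_all only: e emb_simps bounded_clinear_simps[OF unitary_bcl[OF U]] n mult_1_right order_refl)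
  moreover have "surj (CMV \<alpha>)"
  proof (rule surjI)
    fix y
    have c: "\<And>n. cmod (cnj (\<alpha> n)) \<le> 1" using \<alpha> by simp
    have inv: "blk p (extend \<alpha>) (blk p (\<lambda>n. cnj (extend \<alpha> n)) x) = x" for p x
      using blk_inverse[of "\<lambda>n. cnj (extend \<alpha> n)" p x] cmod_extend_le[of \<alpha>] \<alpha> by simp
    have "emb (CMV \<alpha> (CMV_M (\<lambda>n. cnj (\<alpha> n)) (CMV_L (\<lambda>n. cnj (\<alpha> n)) y))) = emb y"
      by (simp add: CMV_def emb_CMV_L emb_CMV_M \<alpha> c extend_cnj inv)
    then show "CMV \<alpha> (CMV_M (\<lambda>n. cnj (\<alpha> n)) (CMV_L (\<lambda>n. cnj (\<alpha> n)) y)) = y" by simp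
  qed
  ultimately show ?thesis by (simp add: unitary_op_def n)
qed

lemma norm_shifted_CMV:
  assumes \<alpha>: "\<And>n. cmod (\<alpha> n) \<le> 1"
  shows "norm (shifted (CMV \<alpha>) z x) = norm (pencil 0 z (extend \<alpha>) (emb x))"
proof -
  have "norm (shifted (CMV \<alpha>) z x) = norm (shifted (ext_CMV (extend \<alpha>)) z (emb x))"
    by (subst norm_emb[symmetric]) (simp only: shifted_def emb_simps emb_CMV[of \<alpha>, OF \<alpha>])
  also have "\<dots> = norm (pencil 0 z (extend \<alpha>) (emb x))"
    by (rule norm_pencil_even[symmetric]) (auto simp: cmod_extend_le \<alpha>)
  finally show ?thesis .
qed

text \<open>The entries of \<open>pencil\<close> as a formal expression, applicable to sequences
  that are not square-summable.\<close>

definition pform :: "int \<Rightarrow> complex \<Rightarrow> (int \<Rightarrow> complex) \<Rightarrow> (int \<Rightarrow> complex) \<Rightarrow> int \<Rightarrow> complex" where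
  "pform p z \<beta> f n =
    (if even (n + p)
     then rho (\<beta> (n - 1)) * f (n - 1) - (\<beta> (n - 1) + z * \<beta> n) * f n - z * rho (\<beta> n) * f (n + 1)
     else - z * rho (\<beta> (n - 1)) * f (n - 1)
       + (cnj (\<beta> n) + z * cnj (\<beta> (n - 1))) * f n + rho (\<beta> n) * f (n + 1))"

lemma ell2_nth_pencil_pform:
  assumes "\<And>n. cmod (\<beta> n) \<le> 1"
  shows "ell2_nth (pencil p z \<beta> x) n = pform p z \<beta> (ell2_nth x) n"
  unfolding pform_def by (rule ell2_nth_pencil) (rule assms)

text \<open>This is a three-term recurrence. The coefficient of \<open>f (n + 1)\<close> is
  \<open>rho (\<beta> n)\<close>, up to a factor \<open>- z\<close>, so two consecutive zeros
  propagate to the right.\<close>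

lemma pform_unique:
  assumes z: "z \<noteq> 0" and r: "\<And>n. n \<ge> 0 \<Longrightarrow> rho (\<beta> n) \<noteq> 0"
    and f0: "\<And>n. n \<le> 0 \<Longrightarrow> f n = 0" and pf: "\<And>n. n \<ge> 0 \<Longrightarrow> pform p z \<beta> f n = 0"
  shows "f n = 0"
proof -
  have "f (int k) = 0 \<and> f (int k - 1) = 0" for k
  proof (induction k)
    case 0 then show ?case by (simp add: f0)
  next
    case (Suc k)
    then have "f (int k + 1) = 0"
      using pf[of "int k"] r[of "int k"] z by (auto simp: pform_def split: if_splits)
    then show ?case using Suc by (simp add: add.commute)
  qed
  from this[of "nat n"] show ?thesis using f0[of n] by (cases "n \<le> 0") auto
qed

section \<open>Fredholmness\<close>

text \<open>Weyl's singular sequences, with weak convergence to zero replaced by vanishing on the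
  first \<open>N\<close> coordinates. The strict inequality forces \<open>x\<close> to be
  nonzero.\<close>

definition weyl :: "(nat ell2 \<Rightarrow> nat ell2) \<Rightarrow> complex \<Rightarrow> bool" where
  "weyl U z \<longleftrightarrow> (\<forall>e>0. \<forall>N. \<exists>x. (\<forall>n<N. ell2_nth x n = 0) \<and> norm (shifted U z x) < e * norm x)"

section \<open>Finite-dimensional kernels and closed subspaces\<close>

definition basis_vec :: "'i \<Rightarrow> 'i ell2" where
  "basis_vec k = Abs_ell2 (\<lambda>i. if i = k then 1 else 0)"

lemma ell2_nth_basis_vec [simp]: "ell2_nth (basis_vec k) i = (if i = k then 1 else 0)"
proof -
  have "(\<lambda>i. (cmod (if i = k then 1 else 0))\<^sup>2) summable_on UNIV"
    by (rule summable_on_cong_neutral[THEN iffD1, OF _ _ _ summable_on_finite[of "{k}"]]) auto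
  then show ?thesis by (simp add: basis_vec_def Abs_ell2_inverse)
qed

lemma tendsto_ell2_nth:
  assumes "X \<longlonglongrightarrow> x"
  shows "(\<lambda>n. ell2_nth (X n) i) \<longlonglongrightarrow> ell2_nth x i"
proof (rule LIM_zero_cancel, rule Lim_null_comparison)
  show "(\<lambda>n. norm (X n - x)) \<longlonglongrightarrow> 0"
    using assms by (intro tendsto_norm_zero LIM_zero)
  show "\<forall>\<^sub>F n in sequentially. norm (ell2_nth (X n) i - ell2_nth x i) \<le> norm (X n - x)"
    using cmod_nth_le_norm[of "X n - x" i for n] by simp
qed

text \<open>Such a subspace embeds into an \<open>N\<close>-dimensional space. The induction splits
  off a vector that is nonzero at the last coordinate and keeps the subspace where that coordinate
  vanishes.\<close>

lemma finite_span_if_coordinates_separate: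
  fixes K :: "nat ell2 set"
  assumes "ell2.subspace K" "\<And>x. x \<in> K \<Longrightarrow> (\<And>n. n < N \<Longrightarrow> ell2_nth x n = 0) \<Longrightarrow> x = 0"
  shows "\<exists>B. finite B \<and> K = ell2.span B"
  using assms
proof (induction N arbitrary: K)
  case 0
  then have "K = {0}" using ell2.subspace_0 by auto
  then show ?case by (intro exI[of _ "{}"]) simp
next
  case (Suc N)
  show ?case
  proof (cases "\<forall>x\<in>K. (\<forall>n<N. ell2_nth x n = 0) \<longrightarrow> x = 0")
    case True then show ?thesis using Suc.IH[OF Suc.prems(1)] by blast
  next
    case False
    then obtain b where b: "b \<in> K" "\<And>n. n < N \<Longrightarrow> ell2_nth b n = 0" "b \<noteq> 0" by blast
    then have bN: "ell2_nth b N \<noteq> 0" using Suc.prems(2)[OF b(1)] by (auto simp: less_Suc_eq)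
    define K' where "K' = {x \<in> K. ell2_nth x N = 0}"
    have "ell2.subspace K'"
      using Suc.prems(1) by (auto simp: ell2.subspace_def K'_def)
    moreover have "x = 0" if "x \<in> K'" "\<And>n. n < N \<Longrightarrow> ell2_nth x n = 0" for x
      using that Suc.prems(2)[of x] by (auto simp: K'_def less_Suc_eq)
    ultimately obtain B where B: "finite B" "K' = ell2.span B" using Suc.IH[of K'] by blast
    have "K = ell2.span (insert b B)"
    proof (intro set_eqI iffI)
      fix x assume "x \<in> K"
      then have "x - (ell2_nth x N / ell2_nth b N) *\<^sub>C b \<in> K'"
        using b(1) bN Suc.prems(1)
        by (auto simp: K'_def intro!: ell2.subspace_diff ell2.subspace_scale)
      then show "x \<in> ell2.span (insert b B)" unfolding ell2.span_insert B by blast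
    next
      fix x assume "x \<in> ell2.span (insert b B)"
      then obtain k where "x - k *\<^sub>C b \<in> K" unfolding ell2.span_insert B(2)[symmetric] K'_def by blast
      then have "(x - k *\<^sub>C b) + k *\<^sub>C b \<in> K"
        using b(1) Suc.prems(1) by (intro ell2.subspace_add ell2.subspace_scale)
      then show "x \<in> K" by simp
    qed
    then show ?thesis using B(1) by blast
  qed
qed

text \<open>If \<open>v\<close> is outside \<open>M\<close>, its positive distance to
  \<open>M\<close> bounds the coefficient of \<open>v\<close> by the norm of the sum. Along a
  convergent sequence of sums the coefficients therefore converge, and with them the parts in
  \<open>M\<close>.\<close>

lemma closed_subspace_plus_line:
  fixes M :: "'i ell2 set"
  assumes M: "closed M" "ell2.subspace M"
  shows "closed {m + c *\<^sub>C v | m c. m \<in> M}" (is "closed ?S")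
proof (cases "v \<in> M")
  case True
  have "?S = M"
  proof (intro set_eqI iffI)
    fix x assume "x \<in> ?S" then show "x \<in> M"
      using True M(2) by (auto intro!: ell2.subspace_add ell2.subspace_scale)
  next
    fix x assume "x \<in> M"
    moreover have "x = x + 0 *\<^sub>C v" by simp
    ultimately show "x \<in> ?S" by blast
  qed
  then show ?thesis using M by simp
next
  case False
  have ne: "M \<noteq> {}" using ell2.subspace_0[OF M(2)] by auto
  define d where "d = infdist v M"
  have "d > 0" using False M(1) ne by (simp add: d_def infdist_pos_not_in_closed)
  have low: "cmod c * d \<le> norm (m + c *\<^sub>C v)" if "m \<in> M" for m c
  proof (cases "c = 0")
    case False
    have "(- 1 / c) *\<^sub>C m \<in> M" using that M(2) by (intro ell2.subspace_scale)
    then have "d \<le> norm (v - (- 1 / c) *\<^sub>C m)"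
      unfolding d_def dist_norm[symmetric] by (rule infdist_le)
    then have "cmod c * d \<le> norm (c *\<^sub>C (v - (- 1 / c) *\<^sub>C m))" by (simp add: mult_left_mono)
    also have "c *\<^sub>C (v - (- 1 / c) *\<^sub>C m) = m + c *\<^sub>C v"
      by (rule ell2_eqI) (use False in \<open>simp add: field_simps\<close>)
    finally show ?thesis .
  qed simp
  show ?thesis unfolding closed_sequential_limits
  proof (intro allI impI, elim conjE)
    fix X y assume X: "\<forall>n. X n \<in> ?S" and lim: "X \<longlonglongrightarrow> y"
    then have "\<forall>n. \<exists>m c. m \<in> M \<and> X n = m + c *\<^sub>C v" by blast
    then obtain m c where mc: "\<And>n. m n \<in> M" "\<And>n. X n = m n + c n *\<^sub>C v" by metis
    have "Cauchy c"
    proof (rule metric_CauchyI)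
      fix e :: real assume "e > 0"
      obtain L where L: "\<And>a b. a \<ge> L \<Longrightarrow> b \<ge> L \<Longrightarrow> dist (X a) (X b) < e * d"
        using metric_CauchyD[OF LIMSEQ_imp_Cauchy[OF lim], of "e * d"] \<open>e > 0\<close> \<open>d > 0\<close> by auto
      have "dist (c a) (c b) < e" if "a \<ge> L" "b \<ge> L" for a b
      proof -
        have "m a - m b \<in> M" using mc(1) M(2) by (intro ell2.subspace_diff)
        then have "cmod (c a - c b) * d \<le> norm ((m a - m b) + (c a - c b) *\<^sub>C v)" by (rule low)
        also have "(m a - m b) + (c a - c b) *\<^sub>C v = X a - X b"
          by (simp add: mc(2) ell2.scale_left_diff_distrib)
        finally have "cmod (c a - c b) * d < e * d" using L[OF that] by (simp add: dist_norm)
        then show ?thesis using \<open>d > 0\<close> by (simp add: dist_norm)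
      qed
      then show "\<exists>L. \<forall>a\<ge>L. \<forall>b\<ge>L. dist (c a) (c b) < e" by blast
    qed
    then obtain l where l: "c \<longlonglongrightarrow> l" using Cauchy_convergent convergent_def by blast
    have "(\<lambda>n. c n *\<^sub>C v) \<longlonglongrightarrow> l *\<^sub>C v"
    proof (rule LIM_zero_cancel, rule tendsto_norm_zero_cancel)
      have "(\<lambda>n. cmod (c n - l) * norm v) \<longlonglongrightarrow> 0 * norm v"
        by (intro tendsto_intros tendsto_norm_zero LIM_zero l)
      then show "(\<lambda>n. norm (c n *\<^sub>C v - l *\<^sub>C v)) \<longlonglongrightarrow> 0"
        by (simp flip: ell2.scale_left_diff_distrib)
    qed
    from tendsto_diff[OF lim this] have "m \<longlonglongrightarrow> y - l *\<^sub>C v" by (simp add: mc(2))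
    then have "y - l *\<^sub>C v \<in> M" by (rule closed_sequentially[OF M(1) mc(1)])
    then show "y \<in> ?S" by (auto intro!: exI[of _ "y - l *\<^sub>C v"] exI[of _ l])
  qed
qed

lemma subspace_vanish: "ell2.subspace {x :: nat ell2. \<forall>n<N. ell2_nth x n = 0}"
  by (auto simp: ell2.subspace_def)

lemma subspace_image_bounded_clinear:
  assumes A: "bounded_clinear A" and S: "ell2.subspace S"
  shows "ell2.subspace (A ` S)"
  unfolding ell2.subspace_def
proof safe
  show "0 \<in> A ` S" using ell2.subspace_0[OF S] bounded_clinear_0[OF A] by force
  fix x y assume "x \<in> S" "y \<in> S"
  then show "A x + A y \<in> A ` S"
    using ell2.subspace_add[OF S] by (metis bounded_clinear_add[OF A] image_eqI)
next
  fix c x assume "x \<in> S"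
  then show "c *\<^sub>C A x \<in> A ` S"
    using ell2.subspace_scale[OF S] by (metis bounded_clinear_scaleC[OF A] image_eqI)
qed

text \<open>Failure of \<open>weyl\<close> makes \<open>A\<close> bounded below on
  \<open>V N\<close>, a subspace of codimension \<open>N\<close>. Hence the kernel is determined by
  \<open>N\<close> coordinates, the range is a closed subspace enlarged by \<open>N\<close> lines,
  and the kernel also fills up the cokernel.\<close>

lemma fredholm_if_not_weyl:
  fixes U :: "nat ell2 \<Rightarrow> nat ell2"
  assumes U: "unitary_op U" and z: "cmod z = 1" and nw: "\<not> weyl U z"
  shows "fredholm (shifted U z)"
proof -
  define A where "A = shifted U z"
  have A: "bounded_clinear A" unfolding A_def by (rule bounded_clinear_shifted[OF unitary_bcl[OF U]])
  have A_tendsto: "(\<lambda>n. A (X n)) \<longlonglongrightarrow> A x" if "X \<longlonglongrightarrow> x" for X x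
    using bounded_linear.tendsto[OF bounded_clinear_bl[OF A] that] .
  define V where "V N = {x :: nat ell2. \<forall>n<N. ell2_nth x n = 0}" for N
  obtain e N where "e > 0"
    "\<forall>x. (\<forall>n<N. ell2_nth x n = 0) \<longrightarrow> \<not> norm (A x) < e * norm x"
    using nw unfolding weyl_def A_def by blast
  then have e: "e > 0" "\<And>x. x \<in> V N \<Longrightarrow> e * norm x \<le> norm (A x)"
    by (auto simp: V_def not_less)
  have sV: "ell2.subspace (V k)" for k unfolding V_def by (rule subspace_vanish)
  have complete: "\<exists>x\<in>V N. X \<longlonglongrightarrow> x"
    if X: "\<And>n. X n \<in> V N" and y: "(\<lambda>n. A (X n)) \<longlonglongrightarrow> y" for X y
  proof -
    have "Cauchy X"
    proof (rule metric_CauchyI)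
      fix d :: real assume "d > 0"
      obtain L where L: "\<And>a b. a \<ge> L \<Longrightarrow> b \<ge> L \<Longrightarrow> dist (A (X a)) (A (X b)) < e * d"
        using metric_CauchyD[OF LIMSEQ_imp_Cauchy[OF y], of "e * d"] \<open>e > 0\<close> \<open>d > 0\<close> by auto
      have "dist (X a) (X b) < d" if "a \<ge> L" "b \<ge> L" for a b
      proof -
        have "e * norm (X a - X b) \<le> norm (A (X a - X b))"
          by (rule e) (use X sV in \<open>intro ell2.subspace_diff\<close>)
        also have "\<dots> < e * d" using L[OF that] by (simp add: bounded_clinear_diff[OF A] dist_norm)
        finally show ?thesis using e(1) by (simp add: dist_norm)
      qed
      then show "\<exists>L. \<forall>a\<ge>L. \<forall>b\<ge>L. dist (X a) (X b) < d" by blast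
    qed
    then obtain x where x: "X \<longlonglongrightarrow> x" using Cauchy_convergent convergent_def by blast
    have "ell2_nth x n = 0" if "n < N" for n
      using tendsto_ell2_nth[OF x, of n] X that by (simp add: V_def LIMSEQ_const_iff)
    then show ?thesis using x by (auto simp: V_def)
  qed
  have closed_AV: "closed (A ` V N)" unfolding closed_sequential_limits
  proof (intro allI impI, elim conjE)
    fix Y y assume Y: "\<forall>n. Y n \<in> A ` V N" and y: "Y \<longlonglongrightarrow> y"
    then have "\<forall>n. \<exists>x. x \<in> V N \<and> Y n = A x" by blast
    from choice[OF this] obtain X where X: "\<And>n. X n \<in> V N" "\<And>n. Y n = A (X n)" by blast
    have "Y = (\<lambda>n. A (X n))" using X(2) by (rule ext)
    then have AX: "(\<lambda>n. A (X n)) \<longlonglongrightarrow> y" using y by simp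
    with X(1) obtain x where x: "x \<in> V N" "X \<longlonglongrightarrow> x" using complete by blast
    have "y = A x" by (rule LIMSEQ_unique[OF AX A_tendsto[OF x(2)]])
    then show "y \<in> A ` V N" using x by blast
  qed
  \<comment> \<open>The missing basis vectors are added one at a time, descending from
    \<open>V N\<close> to the whole space \<open>V 0\<close>.\<close>
  have "closed (A ` V 0)"
  proof (rule inc_induct[of 0 N "\<lambda>k. closed (A ` V k)"])
    show "closed (A ` V N)" by (rule closed_AV)
    fix k assume c: "closed (A ` V (Suc k))"
    have "A ` V k = {m + c *\<^sub>C A (basis_vec k) | m c. m \<in> A ` V (Suc k)}"
    proof (intro set_eqI iffI)
      fix y assume "y \<in> A ` V k"
      then obtain x where x: "x \<in> V k" "y = A x" by blast
      define u where "u = x - ell2_nth x k *\<^sub>C basis_vec k"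
      have "u \<in> V (Suc k)" using x(1) by (auto simp: u_def V_def less_Suc_eq)
      moreover have "y = A u + ell2_nth x k *\<^sub>C A (basis_vec k)"
        by (simp add: u_def x(2) bounded_clinear_simps[OF A])
      ultimately show "y \<in> {m + c *\<^sub>C A (basis_vec k) | m c. m \<in> A ` V (Suc k)}" by blast
    next
      fix y assume "y \<in> {m + c *\<^sub>C A (basis_vec k) | m c. m \<in> A ` V (Suc k)}"
      then obtain u c where u: "u \<in> V (Suc k)" "y = A u + c *\<^sub>C A (basis_vec k)" by blast
      then have "y = A (u + c *\<^sub>C basis_vec k)" by (simp add: bounded_clinear_simps[OF A])
      moreover have "u + c *\<^sub>C basis_vec k \<in> V k" using u(1) by (auto simp: V_def)
      ultimately show "y \<in> A ` V k" by blast
    qed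
    then show "closed (A ` V k)"
      using closed_subspace_plus_line[OF c subspace_image_bounded_clinear[OF A sV]] by simp
  qed simp
  then have closed: "closed (range A)" by (simp add: V_def)
  define K where "K = {x. A x = 0}"
  have "ell2.subspace K" by (auto simp: K_def ell2.subspace_def bounded_clinear_simps[OF A])
  moreover have "x = 0" if "x \<in> K" "\<And>n. n < N \<Longrightarrow> ell2_nth x n = 0" for x
  proof -
    have "e * norm x \<le> 0" using e(2)[of x] that by (simp add: V_def K_def)
    then show ?thesis using e(1) by (simp add: mult_le_0_iff)
  qed
  ultimately obtain B where B: "finite B" "K = ell2.span B"
    using finite_span_if_coordinates_separate[of K N] by blast
  \<comment> \<open>\<open>z\<close> is approached radially from outside. The solution
    \<open>u m\<close> at \<open>w m\<close> may blow up like \<open>1 / \<delta> m\<close>, but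
    \<open>x m = (w m - z) u m\<close> stays bounded while \<open>A (x m)\<close> tends to 0. A
    limit \<open>k\<close> of a subsequence lies in the kernel, and \<open>y + k\<close> is a limit
    of the vectors \<open>A (u m)\<close>.\<close>
  have "\<exists>k\<in>K. y + k \<in> range A" for y
  proof -
    define \<delta> where "\<delta> m = inverse (real (Suc m))" for m
    have \<delta>0: "\<delta> m > 0" for m by (simp add: \<delta>_def)
    define w where "w m = of_real (1 + \<delta> m) * z" for m
    have "cmod (w m) = 1 + \<delta> m" for m
      unfolding w_def norm_mult norm_of_real using z \<delta>0[of m] by simp
    then have w1: "\<bar>1 - cmod (w m)\<bar> = \<delta> m" "cmod (w m) \<noteq> 1" for m using \<delta>0[of m] by auto
    have wz: "cmod (w m - z) = \<delta> m" for m
    proof -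
      have "w m - z = of_real (\<delta> m) * z" by (simp add: w_def algebra_simps)
      then show ?thesis using z \<delta>0[of m] by (simp add: norm_mult)
    qed
    have "\<exists>u. shifted U (w m) u = y" for m
      using unitary_surj_off_circle[OF U w1(2)[of m]] by (metis surjD)
    then obtain u where u: "\<And>m. shifted U (w m) (u m) = y" by metis
    define x where "x m = (w m - z) *\<^sub>C u m" for m
    have Au: "A (u m) = y + x m" for m
      unfolding u[of m, symmetric] by (simp add: A_def shifted_def x_def ell2.scale_left_diff_distrib)
    have nx: "norm (x m) \<le> norm y" for m
      using unitary_shifted_norm_ge[OF U, of "w m" "u m"] by (simp add: x_def wz w1 u)
    have "A (x m) = (w m - z) *\<^sub>C (y + x m)" for m
      by (simp add: x_def bounded_clinear_scaleC[OF A] Au[unfolded x_def])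
    then have "norm (A (x m)) \<le> \<delta> m * (2 * norm y)" for m
      using norm_triangle_ineq[of y "x m"] nx[of m] \<delta>0[of m] by (simp add: wz)
    moreover have "(\<lambda>m. \<delta> m * (2 * norm y)) \<longlonglongrightarrow> 0"
      unfolding \<delta>_def by (rule tendsto_mult_left_zero[OF LIMSEQ_inverse_real_of_nat])
    ultimately have Ax: "(\<lambda>m. A (x m)) \<longlonglongrightarrow> 0"
      by (intro Lim_null_comparison[of "\<lambda>m. A (x m)"]) auto
    have bd: "cmod (ell2_nth (x m) n) \<le> norm y" for m n
      by (rule order_trans[OF cmod_nth_le_norm nx])
    \<comment> \<open>Boundedness yields convergence only in finitely many coordinates. That
      suffices, because the remaining part lies in \<open>V N\<close>, where convergence of the
      images forces convergence of the vectors.\<close>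
    obtain r :: "nat \<Rightarrow> nat" where r: "strict_mono r"
      "\<And>n. n \<in> {..<N} \<Longrightarrow> \<exists>l. (\<lambda>m. ell2_nth (x (r m)) n) \<longlonglongrightarrow> l"
    proof (rule function_convergent_subsequence[of "{..<N}" "\<lambda>m. ell2_nth (x m)" "norm y"])
      show "cmod (ell2_nth (x m) n) \<le> norm y" for m n by (rule bd)
    qed (auto intro: that)
    then have "\<forall>n. \<exists>l. n < N \<longrightarrow> (\<lambda>m. ell2_nth (x (r m)) n) \<longlonglongrightarrow> l" by blast
    from choice[OF this] obtain l where
      l: "\<And>n. n < N \<Longrightarrow> (\<lambda>m. ell2_nth (x (r m)) n) \<longlonglongrightarrow> l n" by blast
    define p where "p = (\<Sum>n<N. l n *\<^sub>C basis_vec n)"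
    have p: "ell2_nth p n = (if n < N then l n else 0)" for n
      by (simp add: p_def if_distrib[of "\<lambda>a. _ * a"] cong: if_cong)
    define P where "P = (trunc {..<N} :: nat ell2 \<Rightarrow> nat ell2)"
    have Pl: "(\<lambda>m. P (x (r m))) \<longlonglongrightarrow> p"
    proof (rule LIM_zero_cancel, rule tendsto_norm_zero_cancel)
      have "(\<lambda>m. sqrt (\<Sum>n<N. (cmod (ell2_nth (x (r m)) n - l n))\<^sup>2)) \<longlonglongrightarrow> sqrt (\<Sum>n<N. (cmod (l n - l n))\<^sup>2)"
        by (intro tendsto_intros l) auto
      moreover have "norm (P (x (r m)) - p) = sqrt (\<Sum>n<N. (cmod (ell2_nth (x (r m)) n - l n))\<^sup>2)" for m
      proof -
        have "(norm (P (x (r m)) - p))\<^sup>2 = (\<Sum>n<N. (cmod (ell2_nth (x (r m)) n - l n))\<^sup>2)"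
          by (subst norm_ell2_sq_finite[of "{..<N}"]) (auto simp: P_def p)
        then show ?thesis by (intro real_sqrt_unique[symmetric]) auto
      qed
      ultimately show "(\<lambda>m. norm (P (x (r m)) - p)) \<longlonglongrightarrow> 0" by simp
    qed
    have "(\<lambda>m. A (x (r m) - P (x (r m)))) \<longlonglongrightarrow> 0 - A p"
      unfolding bounded_clinear_diff[OF A]
      using LIMSEQ_subseq_LIMSEQ[OF Ax r(1)] by (intro tendsto_diff A_tendsto Pl) (simp add: o_def)
    moreover have "x (r m) - P (x (r m)) \<in> V N" for m by (simp add: V_def P_def)
    ultimately obtain q where "(\<lambda>m. x (r m) - P (x (r m))) \<longlonglongrightarrow> q"
      using complete[of "\<lambda>m. x (r m) - P (x (r m))"] by blast
    from tendsto_add[OF this Pl] have k: "(\<lambda>m. x (r m)) \<longlonglongrightarrow> q + p" by simp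
    have "A (q + p) = 0"
      using A_tendsto[OF k] LIMSEQ_subseq_LIMSEQ[OF Ax r(1)] by (simp add: o_def LIMSEQ_unique)
    moreover have "(\<lambda>m. A (u (r m))) \<longlonglongrightarrow> y + (q + p)"
      unfolding Au by (intro tendsto_intros k)
    then have "y + (q + p) \<in> range A" by (rule closed_sequentially[OF closed, rotated]) auto
    ultimately show ?thesis by (auto simp: K_def)
  qed
  then have "y \<in> ell2.span (range A \<union> B)" for y
  proof -
    obtain k where k: "k \<in> K" "y + k \<in> range A" using \<open>\<And>y. \<exists>k\<in>K. y + k \<in> range A\<close> by blast
    have "y + k \<in> ell2.span (range A \<union> B)" using k(2) by (intro ell2.span_base) auto
    moreover have "k \<in> ell2.span (range A \<union> B)" using k(1) ell2.span_mono[of B "range A \<union> B"] B(2) by blast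
    ultimately have "(y + k) - k \<in> ell2.span (range A \<union> B)" by (rule ell2.span_diff)
    then show ?thesis by simp
  qed
  then show ?thesis
    unfolding fredholm_def A_def[symmetric] K_def[symmetric]
    using A B closed by blast
qed

lemma fredholm_off_circle:
  assumes U: "unitary_op U" and z: "cmod z \<noteq> 1"
  shows "fredholm (shifted U z)"
proof -
  have 1: "bounded_clinear (shifted U z)" by (rule bounded_clinear_shifted[OF unitary_bcl[OF U]])
  have 2: "surj (shifted U z)" by (rule unitary_surj_off_circle[OF U z])
  have "{x. shifted U z x = 0} = ell2.span {}"
  proof safe
    fix x assume "shifted U z x = 0"
    then have "\<bar>1 - cmod z\<bar> * norm x \<le> 0" using unitary_shifted_norm_ge[OF U, of z x] by simp
    then show "x \<in> ell2.span {}" using z by (auto simp: mult_le_0_iff)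
  qed (simp add: bounded_clinear_0[OF 1])
  then show ?thesis unfolding fredholm_def using 1 2 by (auto intro!: exI[of _ "{}"] ell2.span_UNIV)
qed

section \<open>Singular sequences\<close>

lemma pform_linear:
  "pform p z \<beta> (\<lambda>i. a * f i - b * g i) n = a * pform p z \<beta> f n - b * pform p z \<beta> g n"
  by (simp add: pform_def algebra_simps)

lemma pform_cong:
  "f (n - 1) = g (n - 1) \<Longrightarrow> f n = g n \<Longrightarrow> f (n + 1) = g (n + 1) \<Longrightarrow> pform p z \<beta> f n = pform p z \<beta> g n"
  by (simp add: pform_def)

text \<open>The blocks move past any fixed finite set, so they only see a small tail of
  \<open>h\<close>.\<close>

lemma norm_trunc_block_tendsto_0:
  fixes h :: "nat ell2"
  assumes "\<And>n. n \<le> a n"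
  shows "(\<lambda>n. norm (trunc {a n..<b n} h)) \<longlonglongrightarrow> 0"
proof (rule LIMSEQ_I)
  fix e :: real assume "e > 0"
  then obtain F where F: "finite F" "norm (h - trunc F h) < e" by (rule trunc_approx)
  obtain N where N: "\<And>k. k \<in> F \<Longrightarrow> k < N" using finite_nat_set_iff_bounded[THEN iffD1, OF F(1)] by blast
  have "norm (trunc {a n..<b n} h) < e" if "n \<ge> N" for n
  proof -
    have "trunc {a n..<b n} h = trunc {a n..<b n} (h - trunc F h)"
    proof (rule ell2_eqI)
      fix k show "ell2_nth (trunc {a n..<b n} h) k = ell2_nth (trunc {a n..<b n} (h - trunc F h)) k"
        using N[of k] assms[of n] that by auto
    qed
    then show ?thesis using norm_trunc_le[of "{a n..<b n}" "h - trunc F h"] F(2) by simp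
  qed
  then show "\<exists>N. \<forall>n\<ge>N. norm (norm (trunc {a n..<b n} h) - 0) < e" by auto
qed

lemma weyl_finite_support:
  assumes U: "unitary_op U" and w: "weyl U z" and "e > 0"
  obtains x M where "norm x = 1" "\<And>n. n < N \<or> M \<le> n \<Longrightarrow> ell2_nth x n = 0" "norm (shifted U z x) < e"
proof -
  have A: "bounded_clinear (shifted U z)" by (rule bounded_clinear_shifted[OF unitary_bcl[OF U]])
  obtain x where x: "\<And>n. n < N \<Longrightarrow> ell2_nth x n = 0" "norm (shifted U z x) < e * norm x"
    using w \<open>e > 0\<close> unfolding weyl_def by blast
  obtain F where F: "finite F" "norm (shifted U z (trunc F x)) < e * norm (trunc F x)"
    using bounded_clinear_approx_finite_support[OF A x(2)] by blast
  define u where "u = trunc F x"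
  obtain M where M: "\<And>k. k \<in> F \<Longrightarrow> k < M" using finite_nat_set_iff_bounded[THEN iffD1, OF F(1)] by blast
  have u: "norm u > 0" using F(2) \<open>e > 0\<close> by (auto simp: u_def)
  show ?thesis
  proof (rule that)
    define c where "c = complex_of_real (1 / norm u)"
    have c: "cmod c = 1 / norm u" using u by (simp add: c_def norm_divide)
    show "norm (c *\<^sub>C u) = 1" using u by (simp add: c)
    show "ell2_nth (c *\<^sub>C u) n = 0" if "n < N \<or> M \<le> n" for n
      using that x(1)[of n] M[of n] by (auto simp: u_def)
    show "norm (shifted U z (c *\<^sub>C u)) < e"
      using F(2) u by (simp add: bounded_clinear_scaleC[OF A] c u_def[symmetric] divide_less_eq)
  qed
qed

text \<open>
  Approximate eigenvectors \<open>x n\<close> with consecutive supports sum to a formal vector \<open>v t = (\<Sum>n. t n *\<^sub>C x n)\<close>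
  outside \<open>\<ell>\<^sup>2\<close> for which \<open>(C - z) (v t)\<close> is a limit of elements of the range. If the range were closed,
  this would be \<open>(C - z) u\<close> for a square-summable \<open>u\<close>, and \<open>v t - u\<close> would be a formal eigenvector.
  Formal eigenvectors form a space of dimension at most one, since all \<open>rho (\<alpha> j)\<close> are nonzero;
  comparing \<open>t n = 1\<close> with \<open>t n = (-1)\<^sup>n\<close> gives a contradiction.
\<close>

lemma not_closed_range_if_weyl:
  assumes \<alpha>: "\<And>n. cmod (\<alpha> n) < 1" and z: "z \<noteq> 0" and w: "weyl (CMV \<alpha>) z"
  shows "\<not> closed (range (shifted (CMV \<alpha>) z))"
proof
  define A where "A = shifted (CMV \<alpha>) z"
  assume "closed (range (shifted (CMV \<alpha>) z))"
  then have closed: "closed (range A)" by (simp add: A_def)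
  have \<alpha>': "\<And>n. cmod (\<alpha> n) \<le> 1" using \<alpha> less_imp_le by blast
  then have e1: "cmod (extend \<alpha> n) \<le> 1" for n by (rule cmod_extend_le)
  have U: "unitary_op (CMV \<alpha>)" by (rule CMV_unitary) (rule \<alpha>')
  have A: "bounded_clinear A" unfolding A_def by (rule bounded_clinear_shifted[OF unitary_bcl[OF U]])
  have rho: "rho (extend \<alpha> n) \<noteq> 0" if "n \<ge> 0" for n
    using \<alpha>[of "nat n"] that abs_square_eq_1[of "cmod (\<alpha> (nat n))"]
    by (auto simp: rho_def extend_def power2_eq_1_iff)
  have "\<exists>x M. norm x = 1 \<and> (\<forall>k. k < N \<or> M \<le> k \<longrightarrow> ell2_nth x k = 0) \<and> norm (A x) < (1/2)^n" for N n
    using weyl_finite_support[OF U w, of "(1/2)^n" N] unfolding A_def by (metis zero_less_power half_gt_zero_iff zero_less_one)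
  then obtain X M where X: "\<And>N n. norm (X N n) = 1"
    "\<And>N n k. k < N \<or> M N n \<le> k \<Longrightarrow> ell2_nth (X N n) k = 0" "\<And>N n. norm (A (X N n)) < (1/2)^n"
    by metis
  \<comment> \<open>Each vector is chosen to start where the previous one has ended, so
    \<open>x n\<close> lives on the block from \<open>a n\<close> up to but excluding
    \<open>a (Suc n)\<close>.\<close>
  define a where "a = rec_nat 0 (\<lambda>n N. M N n)"
  define x where "x n = X (a n) n" for n
  have x1: "norm (x n) = 1" and xA: "norm (A (x n)) < (1/2)^n"
    and x0: "k < a n \<or> a (Suc n) \<le> k \<Longrightarrow> ell2_nth (x n) k = 0" for n k
    using X by (simp_all add: x_def a_def)
  have a_Suc: "a n < a (Suc n)" for n
  proof (rule ccontr)
    assume "\<not> ?thesis"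
    then have "x n = 0" by (intro ell2_eqI) (use x0[of _ n] in \<open>auto simp: not_less\<close>, meson le_less_linear order_trans)
    then show False using x1[of n] by simp
  qed
  then have "strict_mono a" by (simp add: strict_mono_Suc_iff)
  then have a_ge: "n \<le> a n" for n by (rule strict_mono_imp_increasing)
  have a_mono: "m \<le> n \<Longrightarrow> a m \<le> a n" for m n using \<open>strict_mono a\<close> by (simp add: strict_mono_less_eq)
  \<comment> \<open>Terms with \<open>n > k\<close> contribute nothing at coordinate
    \<open>k\<close>, since \<open>x n\<close> vanishes below \<open>a n \<ge> n\<close>; the
    infinite sum is thus finite at each coordinate.\<close>
  define v where "v t k = (\<Sum>n\<le>k. t n * ell2_nth (x n) k)" for t :: "nat \<Rightarrow> complex" and k
  have v_block: "v t k = t n * ell2_nth (x n) k" if "a n \<le> k" "k < a (Suc n)" for t n k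
  proof -
    have "ell2_nth (x m) k = 0" if "m \<noteq> n" for m
    proof (rule x0)
      show "k < a m \<or> a (Suc m) \<le> k"
        using a_mono[of "Suc m" n] a_mono[of "Suc n" m] \<open>a n \<le> k\<close> \<open>k < a (Suc n)\<close> that
        by (cases "m < n") auto
    qed
    then have "v t k = (\<Sum>m\<in>{n}. t m * ell2_nth (x m) k)"
      unfolding v_def using a_ge[of n] that by (intro sum.mono_neutral_right) auto
    then show ?thesis by simp
  qed
  have block: "trunc {a n..<a (Suc n)} h = s *\<^sub>C x n"
    if "\<And>k. a n \<le> k \<Longrightarrow> k < a (Suc n) \<Longrightarrow> ell2_nth h k = s * ell2_nth (x n) k" for h s n
    by (rule ell2_eqI) (use that x0[of _ n] in \<open>auto simp: not_le not_less\<close>)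
  \<comment> \<open>The \<open>x n\<close> are unit vectors, so the modulus of \<open>s n\<close> is
    the norm of block \<open>n\<close> of a square-summable vector.\<close>
  have coeff0: "s \<longlonglongrightarrow> 0"
    if "\<And>n k. a n \<le> k \<Longrightarrow> k < a (Suc n) \<Longrightarrow> ell2_nth h k = s n * ell2_nth (x n) k" for h s
  proof -
    have "norm (trunc {a n..<a (Suc n)} h) = norm (s n)" for n
      using block[of n h "s n"] that by (simp add: x1)
    then show ?thesis
      using norm_trunc_block_tendsto_0[of a "\<lambda>n. a (Suc n)" h] a_ge
      by (simp add: tendsto_norm_zero_iff)
  qed
  define f where "f t u i = (if i \<ge> 0 then v t (nat i) - ell2_nth u (nat i) else 0)"
    for t and u :: "nat ell2" and i :: int
  have formal: "\<exists>u. \<forall>j. pform 0 z (extend \<alpha>) (f t u) j = 0" if t: "\<And>n. cmod (t n) \<le> 1" for t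
  proof -
    define P where "P m = (\<Sum>n<m. t n *\<^sub>C x n)" for m
    have "summable (\<lambda>n. t n *\<^sub>C A (x n))"
    proof (rule summable_comparison_test)
      have "norm (t n *\<^sub>C A (x n)) \<le> (1/2)^n" for n
        using mult_mono[OF t[of n] less_imp_le[OF xA[of n]]] by simp
      then show "\<exists>N. \<forall>n\<ge>N. norm (t n *\<^sub>C A (x n)) \<le> (1/2)^n" by blast
      show "summable (\<lambda>n. (1/2)^n :: real)" by (rule summable_geometric) simp
    qed
    then obtain y where "(\<lambda>n. t n *\<^sub>C A (x n)) sums y" by (auto simp: summable_def)
    then have y: "(\<lambda>m. A (P m)) \<longlonglongrightarrow> y"
      by (simp add: sums_def P_def bounded_clinear_sum[OF A] bounded_clinear_scaleC[OF A])
    then have "y \<in> range A" by (rule closed_sequentially[OF closed, rotated]) auto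
    then obtain u where u: "y = A u" by blast
    have "(\<lambda>m. norm (A (P m - u))) \<longlonglongrightarrow> 0"
      using y by (simp add: u bounded_clinear_diff[OF A] LIM_zero tendsto_norm_zero)
    then have n0: "(\<lambda>m. norm (pencil 0 z (extend \<alpha>) (emb (P m - u)))) \<longlonglongrightarrow> 0"
      by (simp only: A_def norm_shifted_CMV[of \<alpha>, OF \<alpha>'])
    have "pform 0 z (extend \<alpha>) (f t u) j = 0" for j
    proof -
      have "(\<lambda>m. pform 0 z (extend \<alpha>) (ell2_nth (emb (P m - u))) j) \<longlonglongrightarrow> 0"
        by (rule Lim_null_comparison[OF always_eventually n0])
          (metis cmod_nth_le_norm ell2_nth_pencil_pform[of "extend \<alpha>", OF e1])
      moreover have "\<forall>\<^sub>F m in sequentially. pform 0 z (extend \<alpha>) (ell2_nth (emb (P m - u))) j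
          = pform 0 z (extend \<alpha>) (f t u) j"
        \<comment> \<open>The expression at \<open>j\<close> reads coordinates up to
          \<open>j + 1\<close>; once \<open>m\<close> exceeds this, the partial sum
          \<open>P m\<close> agrees there with the formal sum.\<close>
        using eventually_gt_at_top[of "nat (j + 1)"]
      proof eventually_elim
        case (elim m)
        have "ell2_nth (P m) k = v t k" if "k < m" for k
        proof -
          have "(\<Sum>n<m. t n * ell2_nth (x n) k) = (\<Sum>n\<le>k. t n * ell2_nth (x n) k)"
          proof (rule sum.mono_neutral_right)
            show "\<forall>n\<in>{..<m} - {..k}. t n * ell2_nth (x n) k = 0"
              using x0 a_ge by (metis DiffD2 atMost_iff less_le_trans mult_zero_right not_le)
          qed (use that in auto)
          then show ?thesis by (simp add: P_def v_def)
        qed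
        then have *: "ell2_nth (emb (P m - u)) i = f t u i" if "i \<le> j + 1" for i
          using that elim by (auto simp: f_def)
        show ?case by (rule pform_cong; rule *) simp_all
      qed
      ultimately have "(\<lambda>m::nat. pform 0 z (extend \<alpha>) (f t u) j) \<longlonglongrightarrow> 0"
        by (rule Lim_transform_eventually)
      then show ?thesis by (simp add: LIMSEQ_const_iff)
    qed
    then show ?thesis by blast
  qed
  define t1 t2 :: "nat \<Rightarrow> complex" where "t1 n = 1" and "t2 n = (-1)^n" for n
  obtain u1 where u1: "\<And>j. pform 0 z (extend \<alpha>) (f t1 u1) j = 0"
    using formal[of t1] by (auto simp: t1_def)
  obtain u2 where u2: "\<And>j. pform 0 z (extend \<alpha>) (f t2 u2) j = 0"
    using formal[of t2] by (auto simp: t2_def norm_power)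
  \<comment> \<open>Cross-multiplying by the values at 0 gives a formal eigenvector that vanishes at
    0, hence everywhere. Its blocks force \<open>c2 - c1 (-1)^n\<close> to tend to 0, and the two
    parities of \<open>n\<close> give \<open>c1 = 0\<close>. So the first eigenvector alone vanishes
    at 0, and its constant coefficient 1 would have to tend to 0.\<close>
  define c1 c2 where "c1 = f t1 u1 0" and "c2 = f t2 u2 0"
  have g: "c2 * f t1 u1 i - c1 * f t2 u2 i = 0" for i
  proof (rule pform_unique[OF z rho,
        where f="\<lambda>i. c2 * f t1 u1 i - c1 * f t2 u2 i" and p=0])
    show "pform 0 z (extend \<alpha>) (\<lambda>i. c2 * f t1 u1 i - c1 * f t2 u2 i) n = 0" for n
      by (simp add: pform_linear u1 u2)
    show "c2 * f t1 u1 n - c1 * f t2 u2 n = 0" if "n \<le> 0" for n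
    proof (cases "n = 0")
      case False then show ?thesis using that by (simp add: f_def)
    qed (simp add: c1_def c2_def)
  qed
  have "(\<lambda>n. c2 - c1 * (-1)^n) \<longlonglongrightarrow> 0"
  proof (rule coeff0[of "c2 *\<^sub>C u1 - c1 *\<^sub>C u2"])
    fix n k assume "a n \<le> k" "k < a (Suc n)"
    then show "ell2_nth (c2 *\<^sub>C u1 - c1 *\<^sub>C u2) k = (c2 - c1 * (-1)^n) * ell2_nth (x n) k"
      using g[of "int k"] v_block[of n k t1] v_block[of n k t2]
      by (simp add: f_def t1_def t2_def algebra_simps)
  qed
  then have lim: "(\<lambda>n. c2 - c1 * (-1)^(r n)) \<longlonglongrightarrow> 0" if "strict_mono r" for r
    using LIMSEQ_subseq_LIMSEQ[OF _ that] by (fastforce simp: o_def)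
  have "c2 - c1 = 0" using lim[of "\<lambda>n. 2 * n"] by (simp add: strict_mono_def LIMSEQ_const_iff)
  moreover have "c2 + c1 = 0" using lim[of "\<lambda>n. 2 * n + 1"] by (simp add: strict_mono_def LIMSEQ_const_iff)
  ultimately have "(c2 + c1) - (c2 - c1) = 0" by (simp only: diff_zero)
  then have "c1 = 0" by simp
  have f0: "f t1 u1 i = 0" for i
  proof (rule pform_unique[OF z rho _ u1])
    show "f t1 u1 n = 0" if "n \<le> 0" for n
      using that \<open>c1 = 0\<close> by (cases "n = 0") (auto simp: c1_def, auto simp: f_def)
  qed
  have "(\<lambda>n. 1 :: complex) \<longlonglongrightarrow> 0"
  proof (rule coeff0[of u1])
    fix n k assume "a n \<le> k" "k < a (Suc n)"
    then show "ell2_nth u1 k = 1 * ell2_nth (x n) k"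
      using f0[of "int k"] v_block[of n k t1] by (simp add: f_def t1_def)
  qed
  then show False by (simp add: LIMSEQ_const_iff)
qed

lemma weyl_circle:
  assumes U: "unitary_op U" and w: "weyl U z"
  shows "cmod z = 1"
proof (rule ccontr)
  assume "cmod z \<noteq> 1"
  then obtain x where "norm (shifted U z x) < \<bar>1 - cmod z\<bar> * norm x"
    using w unfolding weyl_def by (metis zero_less_abs_iff eq_iff_diff_eq_0)
  then show False using unitary_shifted_norm_ge[OF U, of z x] by simp
qed

lemma ess_spectrum_CMV_iff_weyl:
  assumes \<alpha>: "\<And>n. cmod (\<alpha> n) < 1"
  shows "z \<in> ess_spectrum (CMV \<alpha>) \<longleftrightarrow> weyl (CMV \<alpha>) z"
proof -
  have U: "unitary_op (CMV \<alpha>)" by (rule CMV_unitary) (use \<alpha> less_imp_le in blast)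
  show ?thesis
  proof
    assume "z \<in> ess_spectrum (CMV \<alpha>)"
    then have "\<not> fredholm (shifted (CMV \<alpha>) z)" by (simp add: ess_spectrum_def)
    then show "weyl (CMV \<alpha>) z"
      using fredholm_off_circle[OF U] fredholm_if_not_weyl[OF U] by blast
  next
    assume w: "weyl (CMV \<alpha>) z"
    then have "z \<noteq> 0" using weyl_circle[OF U w] by auto
    then have "\<not> closed (range (shifted (CMV \<alpha>) z))" using not_closed_range_if_weyl[of \<alpha> z, OF \<alpha>] w by blast
    then show "z \<in> ess_spectrum (CMV \<alpha>)" by (simp add: ess_spectrum_def fredholm_def)
  qed
qed

section \<open>Right limits\<close>

lemma norm_tendsto_finite_support:
  assumes F: "finite F" "\<And>j i. i \<notin> F \<Longrightarrow> ell2_nth (X j) i = 0"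
    and lim: "\<And>i. i \<in> F \<Longrightarrow> (\<lambda>j. ell2_nth (X j) i) \<longlonglongrightarrow> ell2_nth x i"
    and x: "\<And>i. i \<notin> F \<Longrightarrow> ell2_nth x i = 0"
  shows "(\<lambda>j. norm (X j)) \<longlonglongrightarrow> norm x"
proof -
  have "(\<lambda>j. \<Sum>i\<in>F. (cmod (ell2_nth (X j) i))\<^sup>2) \<longlonglongrightarrow> (\<Sum>i\<in>F. (cmod (ell2_nth x i))\<^sup>2)"
    by (intro tendsto_intros lim)
  moreover have "(norm (X j))\<^sup>2 = (\<Sum>i\<in>F. (cmod (ell2_nth (X j) i))\<^sup>2)" for j
    by (rule norm_ell2_sq_finite[OF F(1)]) (rule F(2))
  moreover have "(norm x)\<^sup>2 = (\<Sum>i\<in>F. (cmod (ell2_nth x i))\<^sup>2)"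
    by (rule norm_ell2_sq_finite[OF F(1)]) (rule x)
  ultimately have "(\<lambda>j. (norm (X j))\<^sup>2) \<longlonglongrightarrow> (norm x)\<^sup>2" by simp
  from tendsto_real_sqrt[OF this] show ?thesis by simp
qed

text \<open>All images live on \<open>F\<close> and its neighbours, and each entry depends
  continuously on the coefficients up to the unit circle, so coordinatewise limits suffice even when
  some of the limiting \<open>rho\<close> vanish.\<close>

lemma pencil_norm_tendsto:
  assumes \<beta>: "\<And>j n. cmod (b j n) \<le> 1" "\<And>n. cmod (\<beta> n) \<le> 1"
    and lim: "\<And>n. (\<lambda>j. b j n) \<longlonglongrightarrow> \<beta> n" "\<And>n. (\<lambda>j. ell2_nth (X j) n) \<longlonglongrightarrow> ell2_nth x n"
    and F: "finite F" "\<And>j i. i \<notin> F \<Longrightarrow> ell2_nth (X j) i = 0" "\<And>i. i \<notin> F \<Longrightarrow> ell2_nth x i = 0"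
  shows "(\<lambda>j. norm (pencil p z (b j) (X j))) \<longlonglongrightarrow> norm (pencil p z \<beta> x)"
proof (rule norm_tendsto_finite_support)
  let ?G = "F \<union> (\<lambda>i. i + 1) ` F \<union> (\<lambda>i. i - 1) ` F"
  show "finite ?G" using F(1) by simp
  have G: "i \<notin> F" "i - 1 \<notin> F" "i + 1 \<notin> F" if "i \<notin> ?G" for i
    using that by (auto simp: image_iff)
  show "ell2_nth (pencil p z (b j) (X j)) i = 0" if "i \<notin> ?G" for i j
    using G[OF that] by (simp add: ell2_nth_pencil \<beta> F)
  show "ell2_nth (pencil p z \<beta> x) i = 0" if "i \<notin> ?G" for i
    using G[OF that] by (simp add: ell2_nth_pencil \<beta> F)
  show "(\<lambda>j. ell2_nth (pencil p z (b j) (X j)) i) \<longlonglongrightarrow> ell2_nth (pencil p z \<beta> x) i" for i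
  proof (cases "even (i + p)")
    case True
    then show ?thesis by (simp add: ell2_nth_pencil \<beta>) (intro tendsto_intros tendsto_rho lim)
  next
    case False
    then show ?thesis by (simp add: ell2_nth_pencil \<beta>) (intro tendsto_intros tendsto_rho lim)
  qed
qed

lemma right_limit_extend:
  assumes "filterlim m at_top sequentially"
  shows "(\<lambda>j. \<alpha> (nat (int (m j) + l))) \<longlonglongrightarrow> b \<longleftrightarrow> (\<lambda>j. extend \<alpha> (l + int (m j))) \<longlonglongrightarrow> b"
proof (rule tendsto_cong)
  have "\<forall>\<^sub>F j in sequentially. m j \<ge> nat (- l)"
    using assms by (simp add: filterlim_at_top)
  then show "\<forall>\<^sub>F j in sequentially. \<alpha> (nat (int (m j) + l)) = extend \<alpha> (l + int (m j))"
    by eventually_elim (auto simp: extend_def add.commute)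
qed

lemma pencil_parity: "even (p - q) \<Longrightarrow> pencil p z \<beta> = pencil q z \<beta>"
proof -
  assume "even (p - q)"
  then have "even (n + p) \<longleftrightarrow> even (n + q)" "even (n + (p + 1)) \<longleftrightarrow> even (n + (q + 1))" for n
    by presburger+
  then show ?thesis by (intro ext) (simp only: pencil_def blk_def)
qed

lemma weyl_if_right_limit:
  assumes \<alpha>: "\<And>n. cmod (\<alpha> n) \<le> 1" and R: "right_limit_point \<alpha> \<beta>" and z: "z \<in> spectrum (ext_CMV \<beta>)"
  shows "weyl (CMV \<alpha>) z"
  unfolding weyl_def
proof (intro allI impI)
  fix e :: real and N :: nat assume "e > 0"
  have \<beta>: "\<And>n. cmod (\<beta> n) \<le> 1" using R by (simp add: right_limit_point_def)
  have e1: "cmod (extend \<alpha> n) \<le> 1" for n by (intro cmod_extend_le \<alpha>)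
  obtain m where m: "filterlim m at_top sequentially"
    "\<And>l. (\<lambda>j. \<alpha> (nat (int (m j) + l))) \<longlonglongrightarrow> \<beta> l"
    using R unfolding right_limit_point_def by blast
  define b where "b j n = extend \<alpha> (n + int (m j))" for j n
  have b: "(\<lambda>j. b j n) \<longlonglongrightarrow> \<beta> n" for n
    using m right_limit_extend[OF m(1), of \<alpha>] by (simp add: b_def)
  have "\<exists>x F. finite F \<and> (\<forall>i. i \<notin> F \<longrightarrow> ell2_nth x i = 0) \<and> norm (pencil p z \<beta> x) < e * norm x" for p
  proof -
    have P: "bounded_clinear (pencil p z \<beta>)" by (rule pencil_bounded_clinear) (rule \<beta>)
    have "\<exists>x. norm (pencil p z \<beta> x) < e * norm x"
      by (rule spectrum_pencil_approx) (use \<beta> z \<open>e > 0\<close> in auto)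
    then obtain F x where "finite F" "norm (pencil p z \<beta> (trunc F x)) < e * norm (trunc F x)"
      using bounded_clinear_approx_finite_support[OF P] by blast
    then show ?thesis by (intro exI[of _ "trunc F x"] exI[of _ F]) simp
  qed
  then have "\<forall>p. \<exists>q. finite (snd q) \<and> (\<forall>i. i \<notin> snd q \<longrightarrow> ell2_nth (fst q) i = 0)
      \<and> norm (pencil p z \<beta> (fst q)) < e * norm (fst q)" by simp
  from choice[OF this] obtain q where
    q: "\<And>p. finite (snd (q p))" "\<And>p i. i \<notin> snd (q p) \<Longrightarrow> ell2_nth (fst (q p)) i = 0"
      "\<And>p. norm (pencil p z \<beta> (fst (q p))) < e * norm (fst (q p))" by blast
  define x where "x p = fst (q p)" for p
  have ev: "\<forall>\<^sub>F j in sequentially. norm (pencil p z (b j) (x p)) < e * norm (x p)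
      \<and> (\<forall>i\<in>snd (q p). int N \<le> i + int (m j))" for p
  proof (rule eventually_conj)
    have "(\<lambda>j. norm (pencil p z (b j) (x p))) \<longlonglongrightarrow> norm (pencil p z \<beta> (x p))"
      by (rule pencil_norm_tendsto[where F="snd (q p)"]) (use q b \<beta> e1 in \<open>auto simp: b_def x_def\<close>)
    then show "\<forall>\<^sub>F j in sequentially. norm (pencil p z (b j) (x p)) < e * norm (x p)"
      using q(3)[of p] by (intro order_tendstoD) (auto simp: x_def)
    have "\<forall>\<^sub>F j in sequentially. int N \<le> i + int (m j)" for i
    proof -
      have "\<forall>\<^sub>F j in sequentially. nat (int N - i) \<le> m j" using m(1) by (simp add: filterlim_at_top)
      then show ?thesis by eventually_elim auto
    qed
    then show "\<forall>\<^sub>F j in sequentially. \<forall>i\<in>snd (q p). int N \<le> i + int (m j)"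
      using q(1) by (intro eventually_ball_finite) auto
  qed
  \<comment> \<open>The vector to be translated is selected by the parity of \<open>m j\<close>,
    which is known only after \<open>j\<close>; so \<open>j\<close> is chosen to suit the vectors of
    both parities.\<close>
  from eventually_conj[OF ev[of 0] ev[of 1]] obtain j where
    j: "\<And>p. p \<in> {0, 1} \<Longrightarrow> norm (pencil p z (b j) (x p)) < e * norm (x p)"
      "\<And>p i. p \<in> {0, 1} \<Longrightarrow> i \<in> snd (q p) \<Longrightarrow> int N \<le> i + int (m j)"
    using eventually_happens by fastforce
  define p where "p = int (m j) mod 2"
  have p: "p \<in> {0, 1}" "even (int (m j) - p)" by (auto simp: p_def)
  define y where "y = shift (int (m j)) (x p)"
  have y0: "ell2_nth y n = 0" if "n < int N" for n
  proof -
    have "n - int (m j) \<notin> snd (q p)" using j(2)[OF p(1), of "n - int (m j)"] that by auto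
    then show ?thesis using q(2) by (simp add: y_def x_def)
  qed
  then obtain w where w: "emb w = y" using emb_surj[of y] by fastforce
  have "norm (shifted (CMV \<alpha>) z w) = norm (pencil 0 z (extend \<alpha>) y)"
    unfolding w[symmetric] by (rule norm_shifted_CMV) (rule \<alpha>)
  also have "\<dots> = norm (pencil (0 + int (m j)) z (b j) (x p))"
    unfolding y_def b_def by (subst pencil_shift) (simp_all add: e1)
  also have "pencil (0 + int (m j)) z (b j) = pencil p z (b j)"
    by (rule pencil_parity) (use p in simp)
  also have "norm (pencil p z (b j) (x p)) < e * norm w"
    using j(1)[OF p(1)] by (metis w norm_emb norm_shift y_def)
  finally have "norm (shifted (CMV \<alpha>) z w) < e * norm w" .
  moreover have "ell2_nth w n = 0" if "n < N" for n
    using y0[of "int n"] that by (simp flip: w)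
  ultimately show "\<exists>x. (\<forall>n<N. ell2_nth x n = 0) \<and> norm (shifted (CMV \<alpha>) z x) < e * norm x" by blast
qed

lemma weyl_closure:
  assumes "z \<in> closure S" "\<And>w. w \<in> S \<Longrightarrow> weyl U w"
  shows "weyl U z"
  unfolding weyl_def
proof (intro allI impI)
  fix e :: real and N :: nat assume "e > 0"
  then obtain w where w: "w \<in> S" "cmod (w - z) < e/2"
    using assms(1) unfolding closure_approachable dist_norm by (meson half_gt_zero)
  then obtain x where x: "\<forall>n<N. ell2_nth x n = 0" "norm (shifted U w x) < e/2 * norm x"
    using assms(2)[OF w(1)] \<open>e > 0\<close> unfolding weyl_def by (meson half_gt_zero)
  have "shifted U z x = shifted U w x + (w - z) *\<^sub>C x"
    by (simp add: shifted_def ell2.scale_left_diff_distrib)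
  then have "norm (shifted U z x) \<le> norm (shifted U w x) + cmod (w - z) * norm x"
    by (metis norm_triangle_ineq norm_scaleC_ell2)
  also have "\<dots> < e/2 * norm x + e/2 * norm x"
    using x(2) w(2) by (intro add_less_le_mono mult_right_mono) auto
  finally show "\<exists>x. (\<forall>n<N. ell2_nth x n = 0) \<and> norm (shifted U z x) < e * norm x" using x(1) by auto
qed

section \<open>Localization to windows of bounded length\<close>

lemma cmod_sum3_sq_le: "(cmod (a + b + c))\<^sup>2 \<le> 3 * ((cmod a)\<^sup>2 + (cmod b)\<^sup>2 + (cmod c)\<^sup>2)"
proof -
  have "(cmod (a + b + c))\<^sup>2 \<le> (cmod a + cmod b + cmod c)\<^sup>2"
    by (intro power_mono order_trans[OF norm_triangle_ineq] add_right_mono norm_triangle_ineq) auto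
  also have "\<dots> \<le> 3 * ((cmod a)\<^sup>2 + (cmod b)\<^sup>2 + (cmod c)\<^sup>2)"
    using zero_le_power2[of "cmod a - cmod b"] zero_le_power2[of "cmod b - cmod c"]
      zero_le_power2[of "cmod a - cmod c"]
    by (simp add: power2_eq_square algebra_simps)
  finally show ?thesis .
qed

text \<open>
  Cutting \<open>x\<close> off sharply outside a window of length \<open>K\<close> changes the image under the tridiagonal
  operator only at the edges. Summed over all windows the edge terms are \<open>O(\<parallel>x\<parallel>\<^sup>2)\<close>, whereas the
  squared norms of the pieces add up to \<open>K \<parallel>x\<parallel>\<^sup>2\<close>; so some window does well.
\<close>

lemma pencil_localize:
  assumes \<beta>: "\<And>n. cmod (\<beta> n) \<le> 1" and z: "cmod z = 1"
    and F: "finite F" "\<And>i. i \<notin> F \<Longrightarrow> ell2_nth x i = 0"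
    and x: "x \<noteq> 0" "norm (pencil p z \<beta> x) \<le> \<epsilon> * norm x" and K: "K > 0"
  shows "\<exists>a. trunc {a..<a + int K} x \<noteq> 0 \<and>
    (norm (pencil p z \<beta> (trunc {a..<a + int K} x)))\<^sup>2
      \<le> (3 * \<epsilon>\<^sup>2 + 12 / real K) * (norm (trunc {a..<a + int K} x))\<^sup>2"
proof (rule ccontr)
  assume neg: "\<not> ?thesis"
  \<comment> \<open>The 3 comes from squaring a sum of three terms, and
    \<open>12 = 3 * (2 + 2)\<close>: for each of the two neighbours of a site, at most two windows
    separate it from the site. Division by \<open>K\<close> reflects that each site lies in
    \<open>K\<close> windows.\<close>
  define C where "C = 3 * \<epsilon>\<^sup>2 + 12 / real K"
  define B where "B = pencil p z \<beta>"
  define t where "t a = trunc {a..<a + int K} x" for a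
  have B0: "B 0 = 0" unfolding B_def by (rule bounded_clinear_0, rule pencil_bounded_clinear) (rule \<beta>)
  obtain lo hi where F': "F \<subseteq> {lo..hi}"
  proof (cases "F = {}")
    case True then show ?thesis using that[of 0 0] by simp
  next
    case False
    have "F \<subseteq> {Min F..Max F}" using F(1) by auto
    then show ?thesis by (rule that)
  qed
  \<comment> \<open>\<open>I\<close> holds the support of \<open>x\<close> and its neighbours, hence
    the support of \<open>B x\<close>; \<open>J\<close> contains every start of a window that meets
    \<open>I\<close>.\<close>
  define I where "I = {lo - 1..hi + 1}"
  define J where "J = {lo - int K - 5..hi + int K + 5}"
  have fin: "finite I" "finite J" by (simp_all add: I_def J_def)
  have x0: "ell2_nth x i = 0" if "i < lo \<or> hi < i" for i
  proof (rule F(2))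
    show "i \<notin> F" using F' that by auto
  qed
  define \<phi> :: "int \<Rightarrow> int \<Rightarrow> real" where "\<phi> a n = of_bool (n \<in> {a..<a + int K})" for a n
  have t_nth: "ell2_nth (t a) n = of_real (\<phi> a n) * ell2_nth x n" for a n
    by (simp add: t_def \<phi>_def)
  have \<phi>_idem: "(\<phi> a n)\<^sup>2 = \<phi> a n" for a n by (simp add: \<phi>_def of_bool_def)
  have \<phi>_sum: "(\<Sum>a\<in>J. \<phi> a n) = K" if "n \<in> I" for n
  proof -
    have "(\<Sum>a\<in>J. \<phi> a n) = (\<Sum>a\<in>{n - int K<..n}. 1)"
      using fin that by (intro sum.mono_neutral_cong_right) (auto simp: \<phi>_def I_def J_def)
    then show ?thesis by simp
  qed
  \<comment> \<open>\<open>\<kappa> s a n\<close> marks the windows with an edge between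
    \<open>n\<close> and \<open>n + s\<close>. For a fixed pair of neighbours only two starts
    \<open>a\<close> do this, one for each end of the window.\<close>
  define \<kappa> :: "int \<Rightarrow> int \<Rightarrow> int \<Rightarrow> real" where "\<kappa> s a n = of_bool (\<phi> a (n + s) \<noteq> \<phi> a n)" for s a n
  have \<kappa>_sum: "(\<Sum>a\<in>J. \<kappa> s a n) \<le> 2" if "s = 1 \<or> s = -1" for s n
  proof -
    have "(\<Sum>a\<in>J. \<kappa> s a n) = (\<Sum>a\<in>{a\<in>J. \<phi> a (n + s) \<noteq> \<phi> a n}. 1)"
      using fin by (intro sum.mono_neutral_cong_right) (auto simp: \<kappa>_def)
    also have "\<dots> = real (card {a\<in>J. \<phi> a (n + s) \<noteq> \<phi> a n})" by simp
    also have "\<dots> \<le> real (card (if s = 1 then {n + 1, n + 1 - int K} else {n, n - int K}))"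
      by (intro of_nat_mono card_mono) (use that in \<open>auto simp: \<phi>_def split: if_splits\<close>)
    also have "\<dots> \<le> 2" by (simp add: card_insert_if)
    finally show ?thesis .
  qed
  have nt: "(norm (t a))\<^sup>2 = (\<Sum>n\<in>I. \<phi> a n * (cmod (ell2_nth x n))\<^sup>2)" for a
  proof -
    have "(norm (t a))\<^sup>2 = (\<Sum>n\<in>I. (cmod (ell2_nth (t a) n))\<^sup>2)"
      using fin x0 by (intro norm_ell2_sq_finite) (auto simp: t_nth I_def)
    then show ?thesis by (simp add: t_nth norm_mult power_mult_distrib \<phi>_idem)
  qed
  have x_sum: "(\<Sum>n\<in>I. (cmod (ell2_nth x n))\<^sup>2) = (norm x)\<^sup>2"
    using fin x0 by (intro norm_ell2_sq_finite[symmetric]) (auto simp: I_def)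
  have sum_t: "(\<Sum>a\<in>J. (norm (t a))\<^sup>2) = K * (norm x)\<^sup>2"
    unfolding nt x_sum[symmetric] sum_distrib_left
    by (subst sum.swap) (simp add: \<phi>_sum flip: sum_distrib_right)
  have pt: "(cmod (ell2_nth (B (t a)) n))\<^sup>2 \<le> 3 * (\<phi> a n * (cmod (ell2_nth (B x) n))\<^sup>2
      + \<kappa> 1 a n * (cmod (ell2_nth x (n + 1)))\<^sup>2 + \<kappa> (-1) a n * (cmod (ell2_nth x (n - 1)))\<^sup>2)" for a n
  proof -
    define c1 c2 where "c1 = (if even (n + p) then - z * rho (\<beta> n) else rho (\<beta> n))"
      and "c2 = (if even (n + p) then rho (\<beta> (n - 1)) else - z * rho (\<beta> (n - 1)))"
    have c: "cmod c1 \<le> 1" "cmod c2 \<le> 1"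
      by (auto simp: c1_def c2_def norm_mult z cmod_rho_le \<beta>)
    \<comment> \<open>Product rule for the cutoff: the commutator with \<open>B\<close> involves
      only the jumps of \<phi> between neighbours.\<close>
    have eq: "ell2_nth (B (t a)) n = of_real (\<phi> a n) * ell2_nth (B x) n
        + c1 * (of_real (\<phi> a (n + 1) - \<phi> a n) * ell2_nth x (n + 1))
        + c2 * (of_real (\<phi> a (n - 1) - \<phi> a n) * ell2_nth x (n - 1))"
      by (simp add: B_def ell2_nth_pencil \<beta> t_nth c1_def c2_def algebra_simps)
    have 1: "(cmod (of_real (\<phi> a n) * ell2_nth (B x) n))\<^sup>2 = \<phi> a n * (cmod (ell2_nth (B x) n))\<^sup>2"
      by (simp add: norm_mult power_mult_distrib \<phi>_idem)
    have 2: "(cmod (c * (of_real (\<phi> a (n + s) - \<phi> a n) * y)))\<^sup>2 \<le> \<kappa> s a n * (cmod y)\<^sup>2"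
      if "cmod c \<le> 1" for c y s
    proof -
      have "(cmod c)\<^sup>2 \<le> 1" using that by (simp add: power_le_one)
      moreover have "(\<phi> a (n + s) - \<phi> a n)\<^sup>2 = \<kappa> s a n" by (simp add: \<phi>_def \<kappa>_def)
      ultimately show ?thesis
        by (simp add: norm_mult power_mult_distrib mult_left_le_one_le \<kappa>_def del: of_real_diff)
    qed
    show ?thesis
      unfolding eq
      using cmod_sum3_sq_le 2[OF c(1), of 1 "ell2_nth x (n + 1)"] 2[OF c(2), of "-1" "ell2_nth x (n - 1)"]
      by (intro order_trans[OF cmod_sum3_sq_le] mult_left_mono add_mono) (auto simp only: 1 order_refl zero_le_numeral, auto)
  qed
  have nB: "(norm (B u))\<^sup>2 = (\<Sum>n\<in>I. (cmod (ell2_nth (B u) n))\<^sup>2)"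
    if "\<And>i. i < lo \<or> hi < i \<Longrightarrow> ell2_nth u i = 0" for u
    using fin that by (intro norm_ell2_sq_finite) (auto simp: B_def I_def ell2_nth_pencil \<beta>)
  have shift_le: "(\<Sum>n\<in>I. (cmod (ell2_nth x (n + s)))\<^sup>2) \<le> (norm x)\<^sup>2" for s
    using sum_le_norm_ell2_sq[OF fin(1), of "shift (- s) x"] by simp
  have edge: "(\<Sum>a\<in>J. \<Sum>n\<in>I. \<kappa> s a n * (cmod (ell2_nth x (n + s)))\<^sup>2) \<le> 2 * (norm x)\<^sup>2"
    if "s = 1 \<or> s = -1" for s
  proof -
    have "(\<Sum>a\<in>J. \<Sum>n\<in>I. \<kappa> s a n * (cmod (ell2_nth x (n + s)))\<^sup>2)
        = (\<Sum>n\<in>I. (\<Sum>a\<in>J. \<kappa> s a n) * (cmod (ell2_nth x (n + s)))\<^sup>2)"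
      by (subst sum.swap) (simp add: sum_distrib_right)
    also have "\<dots> \<le> (\<Sum>n\<in>I. 2 * (cmod (ell2_nth x (n + s)))\<^sup>2)"
      using \<kappa>_sum[OF that] by (intro sum_mono mult_right_mono) auto
    also have "\<dots> \<le> 2 * (norm x)\<^sup>2" using shift_le[of s] by (simp flip: sum_distrib_left)
    finally show ?thesis .
  qed
  have "(\<Sum>a\<in>J. (norm (B (t a)))\<^sup>2) = (\<Sum>a\<in>J. \<Sum>n\<in>I. (cmod (ell2_nth (B (t a)) n))\<^sup>2)"
    by (intro sum.cong nB) (auto simp: t_nth x0)
  also have "\<dots> \<le> (\<Sum>a\<in>J. \<Sum>n\<in>I. 3 * (\<phi> a n * (cmod (ell2_nth (B x) n))\<^sup>2
      + \<kappa> 1 a n * (cmod (ell2_nth x (n + 1)))\<^sup>2 + \<kappa> (-1) a n * (cmod (ell2_nth x (n - 1)))\<^sup>2))"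
    by (intro sum_mono pt)
  also have "\<dots> = 3 * ((\<Sum>a\<in>J. \<Sum>n\<in>I. \<phi> a n * (cmod (ell2_nth (B x) n))\<^sup>2)
      + (\<Sum>a\<in>J. \<Sum>n\<in>I. \<kappa> 1 a n * (cmod (ell2_nth x (n + 1)))\<^sup>2)
      + (\<Sum>a\<in>J. \<Sum>n\<in>I. \<kappa> (-1) a n * (cmod (ell2_nth x (n + (-1))))\<^sup>2))"
    by (simp add: sum.distrib flip: sum_distrib_left)
  also have "(\<Sum>a\<in>J. \<Sum>n\<in>I. \<phi> a n * (cmod (ell2_nth (B x) n))\<^sup>2) = K * (norm (B x))\<^sup>2"
  proof -
    have "(\<Sum>a\<in>J. \<Sum>n\<in>I. \<phi> a n * (cmod (ell2_nth (B x) n))\<^sup>2)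
        = (\<Sum>n\<in>I. (\<Sum>a\<in>J. \<phi> a n) * (cmod (ell2_nth (B x) n))\<^sup>2)"
      by (subst sum.swap) (simp add: sum_distrib_right)
    also have "\<dots> = K * (norm (B x))\<^sup>2"
      using nB[of x] x0 by (simp add: \<phi>_sum sum_distrib_left)
    finally show ?thesis .
  qed
  also have "3 * (K * (norm (B x))\<^sup>2 + (\<Sum>a\<in>J. \<Sum>n\<in>I. \<kappa> 1 a n * (cmod (ell2_nth x (n + 1)))\<^sup>2)
      + (\<Sum>a\<in>J. \<Sum>n\<in>I. \<kappa> (-1) a n * (cmod (ell2_nth x (n + (-1))))\<^sup>2))
      \<le> 3 * (K * (\<epsilon> * norm x)\<^sup>2 + 2 * (norm x)\<^sup>2 + 2 * (norm x)\<^sup>2)"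
    using x(2) by (intro mult_left_mono add_mono edge power_mono) (auto simp: B_def)
  also have "\<dots> = C * (K * (norm x)\<^sup>2)"
    using K by (simp add: C_def power_mult_distrib field_simps)
  finally have up: "(\<Sum>a\<in>J. (norm (B (t a)))\<^sup>2) \<le> C * (\<Sum>a\<in>J. (norm (t a))\<^sup>2)" by (simp add: sum_t)
  have low: "C * (norm (t a))\<^sup>2 \<le> (norm (B (t a)))\<^sup>2" "t a \<noteq> 0 \<Longrightarrow> C * (norm (t a))\<^sup>2 < (norm (B (t a)))\<^sup>2" for a
    using neg unfolding t_def[symmetric] C_def[symmetric] B_def[symmetric] by (cases "t a = 0"; force simp: not_le B0)+
  have "\<exists>a\<in>J. t a \<noteq> 0"
  proof (rule ccontr)
    assume "\<not> ?thesis"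
    then have "(\<Sum>a\<in>J. (norm (t a))\<^sup>2) = 0" by simp
    then show False using K x(1) by (simp add: sum_t)
  qed
  then have "(\<Sum>a\<in>J. C * (norm (t a))\<^sup>2) < (\<Sum>a\<in>J. (norm (B (t a)))\<^sup>2)"
    using low fin by (intro sum_strict_mono_ex1) auto
  then show False using up by (simp add: sum_distrib_left)
qed

text \<open>For fixed \<delta> the window length is fixed, so the translated windows share one
  finite support and a limit of unit vectors is again a unit vector. The right limit may depend on
  \<delta>.\<close>

lemma right_limit_if_weyl:
  assumes \<alpha>: "\<And>n. cmod (\<alpha> n) \<le> 1" and w: "weyl (CMV \<alpha>) z" and "\<delta> > 0"
  shows "\<exists>\<beta> y. right_limit_point \<alpha> \<beta> \<and> y \<noteq> 0 \<and> norm (shifted (ext_CMV \<beta>) z y) \<le> \<delta> * norm y"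
proof -
  have U: "unitary_op (CMV \<alpha>)" by (rule CMV_unitary) (rule \<alpha>)
  have z: "cmod z = 1" by (rule weyl_circle[OF U w])
  have e1: "cmod (extend \<alpha> n) \<le> 1" for n by (intro cmod_extend_le \<alpha>)
  have P: "bounded_clinear (pencil p z (\<lambda>n. extend \<alpha> (n + b)))" for p b
    by (rule pencil_bounded_clinear) (rule e1)
  \<comment> \<open>Localizing at accuracy \<open>\<delta>/4\<close> costs
    \<open>3/16 * \<delta>^2\<close>, and \<open>K \<ge> 24 / \<delta>^2\<close> bounds the edge
    term by half of \<open>\<delta>^2\<close>; together they stay below
    \<open>\<delta>^2\<close>.\<close>
  define K where "K = Suc (nat \<lceil>24 / \<delta>\<^sup>2\<rceil>)"
  have K0: "K > 0" by (simp add: K_def)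
  have "24 / \<delta>\<^sup>2 \<le> real K" unfolding K_def by linarith
  then have K: "3 * (\<delta>/4)\<^sup>2 + 12 / real K \<le> \<delta>\<^sup>2"
    using \<open>\<delta> > 0\<close> K0 by (simp add: field_simps power2_eq_square)
  define S where "S = {0..int K}"
  have "\<exists>b y. int j \<le> b \<and> (\<forall>i. i \<notin> S \<longrightarrow> ell2_nth y i = 0) \<and> norm y = 1
      \<and> norm (pencil 0 z (\<lambda>n. extend \<alpha> (n + b)) y) \<le> \<delta>" for j
  proof -
    \<comment> \<open>Vanishing below \<open>K + 1 + j\<close> forces a window of length
      \<open>K\<close> that meets the support to start beyond \<open>j\<close>, with room for
      rounding the translation down.\<close>
    obtain u M where u: "norm u = 1" "\<And>n. n < K + 1 + j \<or> M \<le> n \<Longrightarrow> ell2_nth u n = 0"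
      "norm (shifted (CMV \<alpha>) z u) < \<delta>/4"
      using weyl_finite_support[OF U w, of "\<delta>/4" "K + 1 + j"] \<open>\<delta> > 0\<close> by auto
    define x where "x = emb u"
    have x: "norm x = 1" "norm (pencil 0 z (extend \<alpha>) x) \<le> \<delta>/4 * norm x"
      using u norm_shifted_CMV[of \<alpha>, OF \<alpha>, of z u] by (simp_all add: x_def)
    have x0: "ell2_nth x i = 0" if "i < int (K + 1 + j) \<or> int M \<le> i" for i
    proof (cases "i < 0")
      case False
      then have "nat i < K + 1 + j \<or> M \<le> nat i" using that by linarith
      then show ?thesis using u(2)[of "nat i"] by (simp add: x_def)
    qed (simp add: x_def)
    have "\<exists>a. trunc {a..<a + int K} x \<noteq> 0 \<and> (norm (pencil 0 z (extend \<alpha>) (trunc {a..<a + int K} x)))\<^sup>2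
        \<le> (3 * (\<delta>/4)\<^sup>2 + 12 / real K) * (norm (trunc {a..<a + int K} x))\<^sup>2"
      by (rule pencil_localize[where F="{0..<int M}"]) (use e1 z x x0 K0 in auto)
    then obtain a where a: "trunc {a..<a + int K} x \<noteq> 0"
      "(norm (pencil 0 z (extend \<alpha>) (trunc {a..<a + int K} x)))\<^sup>2
        \<le> (3 * (\<delta>/4)\<^sup>2 + 12 / real K) * (norm (trunc {a..<a + int K} x))\<^sup>2" by blast
    define t where "t = trunc {a..<a + int K} x"
    have "(norm (pencil 0 z (extend \<alpha>) t))\<^sup>2 \<le> \<delta>\<^sup>2 * (norm t)\<^sup>2"
      using a(2) K mult_right_mono[OF K, of "(norm t)\<^sup>2"] by (simp add: t_def)
    then have "(norm (pencil 0 z (extend \<alpha>) t))\<^sup>2 \<le> (\<delta> * norm t)\<^sup>2" by (simp add: power_mult_distrib)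
    then have Bt: "norm (pencil 0 z (extend \<alpha>) t) \<le> \<delta> * norm t"
      by (rule power2_le_imp_le) (use \<open>\<delta> > 0\<close> in simp)
    have "a \<ge> 2 + int j - 1"
    proof (rule ccontr)
      assume "\<not> ?thesis"
      then have "t = 0" by (intro ell2_eqI) (auto simp: t_def intro!: x0)
      then show False using a(1) by (simp add: t_def)
    qed
    \<comment> \<open>An even translation keeps the parity parameter at 0. Rounding may leave the
      window starting at 1 instead of 0, which is why \<open>S\<close> has one site more than a
      window.\<close>
    define b where "b = a - a mod 2"
    have b: "even b" "b \<le> a" "a \<le> b + 1" by (auto simp: b_def)
    define y where "y = shift (- b) t"
    have ty: "t = shift b y" by (rule ell2_eqI) (simp add: y_def)
    have n: "norm y = norm t" by (simp add: y_def)
    have "norm (pencil 0 z (extend \<alpha>) t) = norm (pencil (0 + b) z (\<lambda>n. extend \<alpha> (n + b)) y)"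
      unfolding ty by (subst pencil_shift) (simp_all add: e1)
    also have "pencil (0 + b) z (\<lambda>n. extend \<alpha> (n + b)) = pencil 0 z (\<lambda>n. extend \<alpha> (n + b))"
      by (rule pencil_parity) (use b in simp)
    finally have By: "norm (pencil 0 z (\<lambda>n. extend \<alpha> (n + b)) y) \<le> \<delta> * norm y" using Bt n by simp
    have y: "norm y > 0" using a(1) n by (simp add: t_def)
    have "ell2_nth y i = 0" if "i \<notin> S" for i
      using that b by (auto simp: y_def t_def S_def)
    moreover define c where "c = complex_of_real (1 / norm y)"
    moreover have c: "cmod c = 1 / norm y" using y by (simp add: c_def norm_divide)
    moreover have "norm (pencil 0 z (\<lambda>n. extend \<alpha> (n + b)) (c *\<^sub>C y)) \<le> \<delta>"
      using By y by (simp add: bounded_clinear_scaleC[OF P] c divide_le_eq)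
    moreover have "int j \<le> b" using \<open>a \<ge> 2 + int j - 1\<close> b by simp
    ultimately show ?thesis using y by (intro exI[of _ b] exI[of _ "c *\<^sub>C y"]) simp
  qed
  then have "\<forall>j. \<exists>q. int j \<le> fst q \<and> (\<forall>i. i \<notin> S \<longrightarrow> ell2_nth (snd q) i = 0) \<and> norm (snd q) = 1
      \<and> norm (pencil 0 z (\<lambda>n. extend \<alpha> (n + fst q)) (snd q)) \<le> \<delta>" by simp
  from choice[OF this] obtain q where q: "\<And>j. int j \<le> fst (q j)"
    "\<And>j i. i \<notin> S \<Longrightarrow> ell2_nth (snd (q j)) i = 0" "\<And>j. norm (snd (q j)) = 1"
    "\<And>j. norm (pencil 0 z (\<lambda>n. extend \<alpha> (n + fst (q j))) (snd (q j))) \<le> \<delta>" by blast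
  \<comment> \<open>Coefficients and vector entries are put into one family over a countable index
    set, so that a single diagonal subsequence makes both converge.\<close>
  define g where "g j s = (case s of Inl l \<Rightarrow> extend \<alpha> (l + fst (q j)) | Inr l \<Rightarrow> ell2_nth (snd (q j)) l)"
    for j and s :: "int + int"
  have g1: "cmod (g j s) \<le> 1" for j s
    using e1 cmod_nth_le_norm[of "snd (q j)"] q(3) by (cases s) (auto simp: g_def)
  obtain r :: "nat \<Rightarrow> nat" where r: "strict_mono r" "\<And>s. s \<in> UNIV \<Longrightarrow> \<exists>l. (\<lambda>j. g (r j) s) \<longlonglongrightarrow> l"
  proof (rule function_convergent_subsequence[of UNIV g 1])
    show "cmod (g j s) \<le> 1" for j s by (rule g1)
  qed (auto intro: that)
  then have "\<forall>s. \<exists>l. (\<lambda>j. g (r j) s) \<longlonglongrightarrow> l" by simp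
  from choice[OF this] obtain L where L: "\<And>s. (\<lambda>j. g (r j) s) \<longlonglongrightarrow> L s" by blast
  define \<beta> where "\<beta> l = L (Inl l)" for l
  have \<beta>: "(\<lambda>j. extend \<alpha> (l + fst (q (r j)))) \<longlonglongrightarrow> \<beta> l" for l
    using L[of "Inl l"] by (simp add: g_def \<beta>_def)
  have \<beta>1: "cmod (\<beta> l) \<le> 1" for l
    by (rule tendsto_upperbound[OF tendsto_norm[OF \<beta>]]) (auto simp: e1)
  define y where "y = (\<Sum>i\<in>S. L (Inr i) *\<^sub>C basis_vec i)"
  have fS: "finite S" by (simp add: S_def)
  have y_nth: "ell2_nth y i = (if i \<in> S then L (Inr i) else 0)" for i
    using fS by (simp add: y_def if_distrib[of "\<lambda>a. _ * a"] cong: if_cong)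
  have y_lim: "(\<lambda>j. ell2_nth (snd (q (r j))) i) \<longlonglongrightarrow> ell2_nth y i" for i
    using L[of "Inr i"] q(2)[of i] by (auto simp: g_def y_nth)
  \<comment> \<open>No mass is lost in the limit because all supports lie in the finite set
    \<open>S\<close>.\<close>
  have "(\<lambda>j. norm (snd (q (r j)))) \<longlonglongrightarrow> norm y"
    by (rule norm_tendsto_finite_support[OF fS _ y_lim]) (use q(2) y_nth in auto)
  then have ny: "norm y = 1" using q(3) by (simp add: LIMSEQ_const_iff)
  have "(\<lambda>j. norm (pencil 0 z (\<lambda>n. extend \<alpha> (n + fst (q (r j)))) (snd (q (r j))))) \<longlonglongrightarrow> norm (pencil 0 z \<beta> y)"
    by (rule pencil_norm_tendsto[where F=S, OF _ _ _ y_lim]) (use e1 \<beta>1 \<beta> fS q(2) y_nth in auto)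
  then have "norm (pencil 0 z \<beta> y) \<le> \<delta>"
    by (rule tendsto_upperbound) (auto simp: q(4))
  moreover have "norm (pencil 0 z \<beta> y) = norm (shifted (ext_CMV \<beta>) z y)"
    by (rule norm_pencil_even) (simp_all add: \<beta>1)
  ultimately have near: "norm (shifted (ext_CMV \<beta>) z y) \<le> \<delta> * norm y" by (simp add: ny)
  define m where "m j = nat (fst (q (r j)))" for j
  have m: "int (m j) = fst (q (r j))" for j using q(1)[of "r j"] by (simp add: m_def)
  have "j \<le> m j" for j
    using q(1)[of "r j"] strict_mono_imp_increasing[OF r(1), of j] m[of j] by linarith
  then have ml: "filterlim m at_top sequentially"
    by (intro filterlim_at_top_mono[OF filterlim_ident]) auto
  have "right_limit_point \<alpha> \<beta>"
    unfolding right_limit_point_def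
  proof (intro conjI allI exI[of _ m])
    show "(\<lambda>j. \<alpha> (nat (int (m j) + l))) \<longlonglongrightarrow> \<beta> l" for l
      using \<beta>[of l] unfolding right_limit_extend[OF ml] by (simp only: m)
  qed (use \<beta>1 ml in auto)
  moreover have "y \<noteq> 0" using ny by auto
  ultimately show ?thesis using near by blast
qed

theorem theorem3p2:
  fixes \<alpha> :: "nat \<Rightarrow> complex"
  assumes "\<And>j. cmod (\<alpha> j) < 1"
  shows "ess_spectrum (CMV \<alpha>) = closure (\<Union>T\<in>right_limits \<alpha>. spectrum T)"
proof (intro set_eqI iffI)
  fix z
  have \<alpha>: "\<And>n. cmod (\<alpha> n) \<le> 1" using assms less_imp_le by blast
  note ess = ess_spectrum_CMV_iff_weyl[of \<alpha>, OF assms]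
  {
    assume "z \<in> ess_spectrum (CMV \<alpha>)"
    then have w: "weyl (CMV \<alpha>) z" by (simp add: ess)
    have z: "cmod z = 1" by (rule weyl_circle[OF CMV_unitary w]) (rule \<alpha>)
    show "z \<in> closure (\<Union>T\<in>right_limits \<alpha>. spectrum T)"
      unfolding closure_approachable
    proof (intro allI impI)
      fix e :: real assume "e > 0"
      then obtain \<beta> y where \<beta>: "right_limit_point \<alpha> \<beta>" "y \<noteq> 0"
        "norm (shifted (ext_CMV \<beta>) z y) \<le> e/2 * norm y"
        using right_limit_if_weyl[of \<alpha> z "e/2", OF \<alpha> w] by auto
      have "unitary_op (ext_CMV \<beta>)"
        using \<beta>(1) by (intro ext_CMV_unitary) (simp add: right_limit_point_def)
      from unitary_spectrum_near[OF this z \<beta>(2,3)] obtain u where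
        u: "u \<in> spectrum (ext_CMV \<beta>)" "cmod (u - z) \<le> e/2" by blast
      then have "dist u z < e" using \<open>e > 0\<close> by (simp add: dist_norm)
      moreover have "ext_CMV \<beta> \<in> right_limits \<alpha>" using \<beta>(1) by (auto simp: right_limits_def)
      ultimately show "\<exists>y\<in>\<Union>T\<in>right_limits \<alpha>. spectrum T. dist y z < e" using u(1) by blast
    qed
  next
    assume "z \<in> closure (\<Union>T\<in>right_limits \<alpha>. spectrum T)"
    then have "weyl (CMV \<alpha>) z"
      by (rule weyl_closure) (auto simp: right_limits_def intro: weyl_if_right_limit[OF \<alpha>])
    then show "z \<in> ess_spectrum (CMV \<alpha>)" by (simp add: ess)
  }
qed

end
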